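(* Let $S \subset \mathbb{R}^n$, $n \ge 2$, be a convex surface. Then $S$ is a convex quadric if and only if there are Cartesian coordinates $\xi_1, \dots, \xi_n$ such that $S$ can be expressed by one of the equations \begin{align*} & a_1 \xi_1^2 + \cdots + a_k \xi_k^2 = 1, \quad 1 \le k \le n, \\ & a_1 \xi_1^2 - a_2 \xi_2^2 - \cdots - a_k \xi_k^2 = 1, \ \xi_1 \ge 0, \quad 2 \le k \le n, \\ & a_1 \xi_1^2 = 0, \\ & a_1 \xi_1^2 - a_2 \xi_2^2 - \cdots - a_k \xi_k^2 = 0, \ \xi_1 \ge 0, \quad 2 \le k \le n, \\ & a_1 \xi_1^2 + \cdots + a_{k-1} \xi_{k-1}^2 = \xi_k, \quad 2 \le k \le n, \end{align*} where all scalars $a_i$ involved are positive.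
   Context: A quadric surface in $\mathbb{R}^n$, $n\ge 2$, is the locus of points $x=(\xi_1,\dots,\xi_n)$ satisfying an equation $\sum_{i,k=1}^n a_{ik}\xi_i\xi_k + 2\sum_{i=1}^n b_i\xi_i + c = 0$ with real coefficients, where not all $a_{ik}$ are zero; it is real if this locus is nonempty. A convex surface is the boundary of an $n$-dimensional convex set in $\mathbb{R}^n$ distinct from $\mathbb{R}^n$ (in particular, a hyperplane and a pair of parallel hyperplanes are convex surfaces). A convex surface $S \subset \mathbb{R}^n$ is a convex quadric if there is a real quadric surface $Q \subset \mathbb{R}^n$ and a convex connected component $U$ of $\mathbb{R}^n \setminus Q$ such that $S$ is the boundary of $U$. Cartesian coordinates are coordinates with respect to some origin and some orthonormal basis. *)

theory Defs
  imports "HOL-Analysis.Analysis"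
begin

text \<open>
  The coefficient matrix is not required to be symmetric. A nonzero antisymmetric matrix gives the
  zero form, but the only nonempty locus this adds is the whole space, whose complement has
  no components.
\<close>

definition quadric_surface :: "(real^'n) set \<Rightarrow> bool" where
  "quadric_surface Q \<longleftrightarrow>
     (\<exists>(a :: 'n \<Rightarrow> 'n \<Rightarrow> real) (b :: 'n \<Rightarrow> real) (c :: real).
        (\<exists>i k. a i k \<noteq> 0) \<and>
        Q = {x. (\<Sum>i\<in>UNIV. \<Sum>k\<in>UNIV. a i k * x $ i * x $ k)
                + 2 * (\<Sum>i\<in>UNIV. b i * x $ i) + c = 0})"

definition real_quadric_surface :: "(real^'n) set \<Rightarrow> bool" where
  "real_quadric_surface Q \<longleftrightarrow> quadric_surface Q \<and> Q \<noteq> {}"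

definition convex_surface :: "(real^'n) set \<Rightarrow> bool" where
  "convex_surface S \<longleftrightarrow>
     (\<exists>K. convex K \<and> aff_dim K = int CARD('n) \<and> K \<noteq> UNIV \<and> S = frontier K)"

definition convex_quadric :: "(real^'n) set \<Rightarrow> bool" where
  "convex_quadric S \<longleftrightarrow> convex_surface S \<and>
     (\<exists>Q U. real_quadric_surface Q \<and> U \<in> components (UNIV - Q) \<and> convex U \<and> S = frontier U)"

text \<open>
  Frames are numbered by \<open>1, \<dots>, CARD('n)\<close>; values of \<open>e\<close> elsewhere are irrelevant.
  Orthonormal vectors in this number automatically form a basis.
\<close>

definition orthonormal_frame :: "(nat \<Rightarrow> real^'n) \<Rightarrow> bool" where
  "orthonormal_frame e \<longleftrightarrow>
     (\<forall>i\<in>{1..CARD('n)}. \<forall>j\<in>{1..CARD('n)}. e i \<bullet> e j = (if i = j then 1 else 0))"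

definition cart_coord :: "real^'n \<Rightarrow> (nat \<Rightarrow> real^'n) \<Rightarrow> real^'n \<Rightarrow> nat \<Rightarrow> real" where
  "cart_coord p e x i = (x - p) \<bullet> e i"

end

theory Submission
  imports Defs
begin

text \<open>
  By the spectral theorem a quadric is the zero set of
  \<open>f(x) = (\<Sum>e\<in>I. l e * ((x - p) \<bullet> e)\<^sup>2) + 2 * ((x - p) \<bullet> b) + g\<close>, with \<open>I\<close> orthonormal, \<open>b\<close> orthogonal
  to \<open>I\<close>, all \<open>l e\<close> nonzero, and \<open>b = 0\<close> or \<open>g = 0\<close>; we may assume that \<open>f > 0\<close> on the convex component
  \<open>U\<close>. If \<open>U\<close> contains a whole line in a direction in which the quadratic part \<open>q\<close> of \<open>f\<close> is positive,
  then \<open>U\<close> is the whole space. Hence the gradient of \<open>f\<close> at a point of \<open>U\<close> is never orthogonal to a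
  direction with \<open>q > 0\<close>, which leaves at most one positive \<open>l e\<close>, and none if \<open>b \<noteq> 0\<close>. In the remaining
  cases \<open>U\<close> meets, and so equals, an explicit convex component: the inside of an elliptic cylinder or
  of a paraboloid, or one side of a hyperboloid or cone, with half-spaces as degenerate cases.
\<close>

subsection \<open>Spectral theorem\<close>


definition orthonormal :: "'a::euclidean_space set \<Rightarrow> bool" where
  "orthonormal B \<longleftrightarrow> (\<forall>u\<in>B. \<forall>v\<in>B. u \<bullet> v = (if u = v then 1 else 0))"

lemma orthonormal_iff: "orthonormal B \<longleftrightarrow> pairwise orthogonal B \<and> (\<forall>u\<in>B. norm u = 1)"
  unfolding orthonormal_def pairwise_def orthogonal_def by (auto simp: norm_eq_1)

lemma orthonormal_subset: "orthonormal B \<Longrightarrow> A \<subseteq> B \<Longrightarrow> orthonormal A"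
  unfolding orthonormal_def by blast

lemma orthonormal_finite: "orthonormal B \<Longrightarrow> finite B"
  using orthonormal_iff pairwise_orthogonal_imp_finite by blast

lemma orthonormal_card_le:
  fixes B :: "'a::euclidean_space set"
  assumes "orthonormal B" shows "card B \<le> DIM('a)"
proof -
  have "0 \<notin> B"
    using assms unfolding orthonormal_def by force
  then have "independent B"
    using assms orthonormal_iff pairwise_orthogonal_independent by blast
  then show ?thesis
    by (simp add: independent_bound)
qed

lemma orthonormal_insert:
  assumes "orthonormal B" "norm u = 1" "\<forall>v\<in>B. u \<bullet> v = 0"
  shows "orthonormal (insert u B)"
  using assms unfolding orthonormal_def by (auto simp: norm_eq_1 inner_commute)

lemma inner_sum_orthonormal:
  assumes "orthonormal B" "A \<subseteq> B" "u \<in> B"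
  shows "(\<Sum>v\<in>A. c v *\<^sub>R v) \<bullet> u = (if u \<in> A then c u else 0)"
proof -
  have "finite A"
    using assms orthonormal_finite orthonormal_subset by blast
  have "(\<Sum>v\<in>A. c v *\<^sub>R v) \<bullet> u = (\<Sum>v\<in>A. if u = v then c v else 0)"
    unfolding inner_sum_left
    using assms unfolding orthonormal_def by (intro sum.cong) auto
  then show ?thesis
    using \<open>finite A\<close> by (simp add: sum.delta')
qed

text \<open>A unit vector of \<open>V\<close> maximizing \<open>x \<bullet> L x\<close> is an
  eigenvector: the residual \<open>L u - l u\<close>, with \<open>l\<close> the maximum, lies again
  in \<open>V\<close>, and were it nonzero, moving along it would increase the Rayleigh
  quotient.\<close>

lemma selfadjoint_eigenvector:
  fixes L :: "'a::euclidean_space \<Rightarrow> 'a"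
  assumes L: "linear L" and sa: "\<And>x y. x \<bullet> L y = L x \<bullet> y"
    and V: "subspace V" "\<And>x. x \<in> V \<Longrightarrow> L x \<in> V" and z: "z \<in> V" "z \<noteq> 0"
  obtains u where "u \<in> V" "norm u = 1" "L u = (u \<bullet> L u) *\<^sub>R u"
proof -
  let ?K = "V \<inter> sphere 0 1"
  have "compact ?K"
    using V by (simp add: closed_Int_compact closed_subspace)
  moreover have "z /\<^sub>R norm z \<in> ?K"
    using z V by (simp add: subspace_scale)
  moreover have "continuous_on ?K (\<lambda>x. x \<bullet> L x)"
    using L by (intro continuous_intros linear_continuous_on linear_linear[THEN iffD2]) auto
  ultimately obtain u where u: "u \<in> ?K" and umax: "\<And>x. x \<in> ?K \<Longrightarrow> x \<bullet> L x \<le> u \<bullet> L u"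
    using continuous_attains_sup[of ?K "\<lambda>x. x \<bullet> L x"] by blast
  define l where "l = u \<bullet> L u"
  \<comment> \<open>The negative residual; the goal is \<open>w = 0\<close>.\<close>
  define w where "w = l *\<^sub>R u - L u"
  have uu: "u \<bullet> u = 1"
    using u by (simp add: norm_eq_1)
  have wV: "w \<in> V"
    using u V by (simp add: w_def subspace_diff subspace_scale)
  have form: "x \<bullet> L x \<le> l * (x \<bullet> x)" if "x \<in> V" for x
  proof (cases "x = 0")
    case False
    have "x /\<^sub>R norm x \<in> ?K"
      using that False V by (simp add: subspace_scale)
    from umax[OF this] have "(x \<bullet> L x) / (norm x)\<^sup>2 \<le> l"
      using L by (simp add: l_def linear_cmul power2_eq_square divide_inverse mult_ac)
    then show ?thesis
      using False by (simp add: pos_divide_le_eq power2_norm_eq_inner)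
  qed (use L in \<open>simp add: linear_0\<close>)
  \<comment> \<open>\<open>form\<close> evaluated at \<open>u + t w\<close>: the constants cancel,
    and the terms linear in \<open>t\<close> combine to \<open>2 * t * (w \<bullet> w)\<close>
    because \<open>w \<bullet> w = l * (w \<bullet> u) - w \<bullet> L u\<close>.\<close>
  have key: "0 \<le> 2 * t * (w \<bullet> w) + t\<^sup>2 * (l * (w \<bullet> w) - w \<bullet> L w)" for t
  proof -
    have "u + t *\<^sub>R w \<in> V"
      using u wV V by (simp add: subspace_add subspace_scale)
    moreover have "(u + t *\<^sub>R w) \<bullet> L (u + t *\<^sub>R w) = l + 2 * t * (w \<bullet> L u) + t\<^sup>2 * (w \<bullet> L w)"
      using sa[of u w] L
      by (simp add: l_def linear_add linear_cmul inner_add_left inner_add_right inner_commute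
          power2_eq_square algebra_simps)
    moreover have "(u + t *\<^sub>R w) \<bullet> (u + t *\<^sub>R w) = 1 + 2 * t * (w \<bullet> u) + t\<^sup>2 * (w \<bullet> w)"
      using uu by (simp add: inner_add_left inner_add_right inner_commute
          power2_eq_square algebra_simps)
    ultimately have "l + 2 * t * (w \<bullet> L u) + t\<^sup>2 * (w \<bullet> L w) \<le> l * (1 + 2 * t * (w \<bullet> u) + t\<^sup>2 * (w \<bullet> w))"
      using form[of "u + t *\<^sub>R w"] by simp
    moreover have "w \<bullet> w = l * (w \<bullet> u) - w \<bullet> L u"
      by (metis inner_diff_right inner_scaleR_right w_def)
    then have "2 * t * (w \<bullet> w) = 2 * t * (l * (w \<bullet> u)) - 2 * t * (w \<bullet> L u)"
      by (metis right_diff_distrib)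
    ultimately show ?thesis
      by (simp add: algebra_simps)
  qed
  have "w \<bullet> w = 0"
  proof (rule ccontr)
    assume "w \<bullet> w \<noteq> 0"
    then have ww: "w \<bullet> w > 0"
      by simp
    define d where "d = l * (w \<bullet> w) - w \<bullet> L w"
    \<comment> \<open>Negative, to make the linear term of \<open>key\<close> negative, and so small
      that \<open>t * d\<close> is at most \<open>w \<bullet> w\<close> in absolute value.\<close>
    define t where "t = - (w \<bullet> w) / (\<bar>d\<bar> + 1)"
    have "t < 0"
      using ww by (simp add: t_def divide_neg_pos)
    have "t * d \<ge> - (w \<bullet> w)"
    proof -
      have "\<bar>t * d\<bar> = (w \<bullet> w) * (\<bar>d\<bar> / (\<bar>d\<bar> + 1))"
        using ww by (simp add: t_def abs_mult)
      also have "\<dots> \<le> (w \<bullet> w) * 1"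
        using ww by (intro mult_left_mono) auto
      finally show ?thesis by simp
    qed
    then have "2 * (w \<bullet> w) + t * d > 0"
      using ww by linarith
    then have "t * (2 * (w \<bullet> w) + t * d) < 0"
      using \<open>t < 0\<close> by (simp add: mult_neg_pos)
    with key[of t] show False
      by (simp add: d_def power2_eq_square algebra_simps)
  qed
  then have "L u = l *\<^sub>R u"
    by (simp add: w_def)
  with u show ?thesis
    by (intro that[of u]) (auto simp: l_def)
qed

text \<open>An orthonormal set of eigenvectors of maximal cardinality is a basis: its orthogonal
  complement is invariant, hence contains another eigenvector if it is nonzero.\<close>

theorem spectral_theorem_selfadjoint:
  fixes L :: "'a::euclidean_space \<Rightarrow> 'a"
  assumes L: "linear L" and sa: "\<And>x y. x \<bullet> L y = L x \<bullet> y"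
  obtains B l where "orthonormal B" "\<And>u. u \<in> B \<Longrightarrow> L u = l u *\<^sub>R u"
    "\<And>x. x = (\<Sum>u\<in>B. (x \<bullet> u) *\<^sub>R u)"
proof -
  define P where "P B \<longleftrightarrow> orthonormal B \<and> (\<forall>u\<in>B. L u = (u \<bullet> L u) *\<^sub>R u)" for B
  have "P {}"
    by (simp add: P_def orthonormal_def)
  moreover have "\<forall>B. P B \<longrightarrow> card B < Suc DIM('a)"
    using orthonormal_card_le by (auto simp: P_def less_Suc_eq_le)
  ultimately obtain B where B: "P B" and Bmax: "\<And>C. P C \<Longrightarrow> card C \<le> card B"
    using ex_has_greatest_nat[of P "{}" card "Suc DIM('a)"] by blast
  have on: "orthonormal B"
    using B by (simp add: P_def)
  define V where "V = {x. \<forall>u\<in>B. x \<bullet> u = 0}"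
  have V: "subspace V"
    by (auto simp: V_def subspace_def inner_add_left)
  have inv: "L x \<in> V" if "x \<in> V" for x
  proof -
    have "L x \<bullet> u = 0" if "u \<in> B" for u
    proof -
      have "L x \<bullet> u = x \<bullet> L u"
        by (simp add: sa)
      also have "\<dots> = (u \<bullet> L u) * (x \<bullet> u)"
        using B \<open>u \<in> B\<close> unfolding P_def by (metis inner_scaleR_right)
      finally show ?thesis
        using \<open>x \<in> V\<close> that by (simp add: V_def)
    qed
    then show ?thesis
      by (simp add: V_def)
  qed
  have V0: "z = 0" if z: "z \<in> V" for z
  proof (rule ccontr)
    assume "z \<noteq> 0"
    then obtain u where u: "u \<in> V" "norm u = 1" "L u = (u \<bullet> L u) *\<^sub>R u"
      using selfadjoint_eigenvector[of L V z, OF L sa V inv z \<open>z \<noteq> 0\<close>] by metis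
    then have "P (insert u B)"
      using B orthonormal_insert[of B u] by (auto simp: P_def V_def)
    moreover have "u \<notin> B"
      using u by (auto simp: V_def norm_eq_1)
    ultimately show False
      using Bmax[of "insert u B"] on orthonormal_finite[of B] by simp
  qed
  have "x = (\<Sum>u\<in>B. (x \<bullet> u) *\<^sub>R u)" for x
  proof -
    have "x - (\<Sum>u\<in>B. (x \<bullet> u) *\<^sub>R u) \<in> V"
      using on by (auto simp: V_def inner_diff_left inner_sum_orthonormal[of B B])
    then show ?thesis
      using V0 by fastforce
  qed
  with on B show ?thesis
    by (intro that[of B "\<lambda>u. u \<bullet> L u"]) (auto simp: P_def)
qed


subsection \<open>Model regions\<close>

text \<open>The segments starting in \<open>S\<close> put \<open>S\<close> into the closure of
  \<open>W\<close>, and closedness of \<open>W \<union> S\<close> leaves room for nothing more, so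
  the frontier is \<open>S\<close>. A connected set properly containing \<open>W\<close> must meet
  this frontier, hence \<open>Q\<close>. The set \<open>Q\<close> may exceed \<open>S\<close>: a
  two-sheeted hyperboloid has a second sheet.\<close>

lemma region_component_and_frontier:
  fixes W :: "'a::real_normed_vector set"
  assumes W: "open W" "convex W" "W \<noteq> {}" and cl: "closed (W \<union> S)" and disj: "W \<inter> S = {}"
    and Q: "S \<subseteq> Q" "W \<inter> Q = {}"
    and ray: "\<And>x. x \<in> S \<Longrightarrow> \<exists>v. \<forall>t. 0 < t \<and> t < 1 \<longrightarrow> x + t *\<^sub>R v \<in> W"
  shows "W \<in> components (UNIV - Q)" and "frontier W = S"
proof -
  have "S \<subseteq> closure W"
  proof
    fix x assume "x \<in> S"
    then obtain v where v: "\<And>t. 0 < t \<Longrightarrow> t < 1 \<Longrightarrow> x + t *\<^sub>R v \<in> W"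
      using ray by blast
    have "((\<lambda>t. x + t *\<^sub>R v) \<longlongrightarrow> x + 0 *\<^sub>R v) (at_right 0)"
      by (intro tendsto_intros)
    moreover have "\<forall>\<^sub>F t in at_right (0::real). x + t *\<^sub>R v \<in> W"
      using v by (auto simp: eventually_at_right_field intro!: exI[of _ 1])
    ultimately show "x \<in> closure W"
      using closure_subset[of W]
      by (intro Lim_in_closed_set[of "closure W" "\<lambda>t. x + t *\<^sub>R v" "at_right 0" x])
        (auto elim: eventually_mono)
  qed
  moreover have "closure W \<subseteq> W \<union> S"
    using cl by (simp add: closure_minimal)
  ultimately show fr: "frontier W = S"
    using W disj by (auto simp: frontier_def interior_open)
  show "W \<in> components (UNIV - Q)"
    unfolding in_components_maximal
  proof (intro conjI allI impI)
    fix D assume D: "D \<noteq> {} \<and> W \<subseteq> D \<and> D \<subseteq> UNIV - Q \<and> connected D"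
    then show "D = W"
      using connected_Int_frontier[of D W] fr Q W by blast
  qed (use W Q convex_connected in auto)
qed

text \<open>Squares are convex: for each \<open>i\<close> the two sides differ by \<open>a i\<close>
  times \<open>u * v * (X - Y)\<^sup>2\<close>. The shift by \<open>p\<close> is harmless because
  \<open>u + v = 1\<close>.\<close>

lemma weighted_square_sum_convex:
  fixes e :: "'i \<Rightarrow> 'a::real_inner" and u v :: real
  assumes "\<And>i. i \<in> J \<Longrightarrow> a i \<ge> 0" "u \<ge> 0" "v \<ge> 0" "u + v = 1"
  shows "(\<Sum>i\<in>J. a i * ((u *\<^sub>R x + v *\<^sub>R y - p) \<bullet> e i)\<^sup>2)
    \<le> u * (\<Sum>i\<in>J. a i * ((x - p) \<bullet> e i)\<^sup>2) + v * (\<Sum>i\<in>J. a i * ((y - p) \<bullet> e i)\<^sup>2)"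
proof -
  have "a i * ((u *\<^sub>R x + v *\<^sub>R y - p) \<bullet> e i)\<^sup>2
      \<le> u * (a i * ((x - p) \<bullet> e i)\<^sup>2) + v * (a i * ((y - p) \<bullet> e i)\<^sup>2)" if "i \<in> J" for i
  proof -
    define X Y where "X = (x - p) \<bullet> e i" and "Y = (y - p) \<bullet> e i"
    have v: "v = 1 - u"
      using assms by simp
    have "(u *\<^sub>R x + v *\<^sub>R y - p) \<bullet> e i = u * X + v * Y"
      by (simp add: X_def Y_def v inner_diff_left inner_add_left algebra_simps)
    moreover have "u * X\<^sup>2 + v * Y\<^sup>2 - (u * X + v * Y)\<^sup>2 = u * v * (X - Y)\<^sup>2"
      by (simp add: v power2_eq_square algebra_simps)
    then have "(u * X + v * Y)\<^sup>2 \<le> u * X\<^sup>2 + v * Y\<^sup>2"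
      using assms by (smt (verit) mult_nonneg_nonneg zero_le_power2)
    then have "a i * (u * X + v * Y)\<^sup>2 \<le> a i * (u * X\<^sup>2 + v * Y\<^sup>2)"
      using assms that by (intro mult_left_mono) auto
    ultimately show ?thesis
      by (simp add: X_def Y_def algebra_simps)
  qed
  then have "(\<Sum>i\<in>J. a i * ((u *\<^sub>R x + v *\<^sub>R y - p) \<bullet> e i)\<^sup>2)
      \<le> (\<Sum>i\<in>J. u * (a i * ((x - p) \<bullet> e i)\<^sup>2) + v * (a i * ((y - p) \<bullet> e i)\<^sup>2))"
    by (rule sum_mono)
  then show ?thesis
    by (simp add: sum.distrib sum_distrib_left)
qed

text \<open>\<open>N\<close> is a convex function, and contraction towards \<open>p\<close> by the
  factor \<open>1 - t\<close> multiplies it by \<open>(1 - t)\<^sup>2\<close>, which supplies the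
  segments from the boundary inwards. The region may be an unbounded cylinder, for instance a slab
  between parallel hyperplanes.\<close>

lemma ellipsoid_region:
  fixes e :: "'i \<Rightarrow> 'a::euclidean_space" and p :: 'a
  assumes a: "\<And>i. i \<in> J \<Longrightarrow> a i > 0"
  defines "N \<equiv> \<lambda>x. \<Sum>i\<in>J. a i * ((x - p) \<bullet> e i)\<^sup>2"
  shows "{x. N x < 1} \<in> components (UNIV - {x. N x = 1})"
    and "frontier {x. N x < 1} = {x. N x = 1}" and "convex {x. N x < 1}"
proof -
  have cont: "continuous_on UNIV N"
    unfolding N_def by (intro continuous_intros)
  show cvx: "convex {x. N x < 1}"
  proof (clarsimp simp: convex_def)
    fix x y and u v :: real
    assume xy: "N x < 1" "N y < 1" and uv: "0 \<le> u" "0 \<le> v" "u + v = 1"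
    have "N (u *\<^sub>R x + v *\<^sub>R y) \<le> u * N x + v * N y"
      unfolding N_def using a uv by (intro weighted_square_sum_convex) (auto intro: less_imp_le)
    also have "\<dots> < 1"
      using xy uv convex_bound_lt by blast
    finally show "N (u *\<^sub>R x + v *\<^sub>R y) < 1" .
  qed
  have op: "open {x. N x < 1}"
    using cont by (simp add: open_Collect_less)
  have ne: "{x. N x < 1} \<noteq> {}"
  proof -
    have "N p = 0" by (simp add: N_def)
    then show ?thesis by (auto intro!: exI[of _ p])
  qed
  have cl: "closed ({x. N x < 1} \<union> {x. N x = 1})"
  proof -
    have "{x. N x < 1} \<union> {x. N x = 1} = {x. N x \<le> 1}" by auto
    then show ?thesis using cont by (simp add: closed_Collect_le)
  qed
  have ray: "\<exists>v. \<forall>t. 0 < t \<and> t < 1 \<longrightarrow> x + t *\<^sub>R v \<in> {x. N x < 1}" if "x \<in> {x. N x = 1}" for x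
  proof (intro exI[of _ "p - x"] allI impI)
    fix t :: real assume t: "0 < t \<and> t < 1"
    have "N (x + t *\<^sub>R (p - x)) = (\<Sum>i\<in>J. (1 - t)\<^sup>2 * (a i * ((x - p) \<bullet> e i)\<^sup>2))"
      unfolding N_def
    proof (intro sum.cong refl)
      fix i
      have "(x + t *\<^sub>R (p - x) - p) \<bullet> e i = (1 - t) * ((x - p) \<bullet> e i)"
        by (simp add: inner_diff_left inner_add_left algebra_simps)
      then show "a i * ((x + t *\<^sub>R (p - x) - p) \<bullet> e i)\<^sup>2 = (1 - t)\<^sup>2 * (a i * ((x - p) \<bullet> e i)\<^sup>2)"
        by (simp add: power_mult_distrib)
    qed
    also have "\<dots> = (1 - t)\<^sup>2 * N x"
      by (simp add: N_def sum_distrib_left)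
    finally show "x + t *\<^sub>R (p - x) \<in> {x. N x < 1}"
      using t that by (simp add: power_less_one_iff)
  qed
  show "{x. N x < 1} \<in> components (UNIV - {x. N x = 1})"
    and "frontier {x. N x < 1} = {x. N x = 1}"
    by (rule region_component_and_frontier[where Q = "{x. N x = 1}", OF op cvx ne cl _ _ _ ray]; auto)+
qed

text \<open>Translation along \<open>d\<close> leaves \<open>N\<close> unchanged and raises
  \<open>(x - p) \<bullet> d\<close>; this yields a point of the region and the segments leaving the
  boundary. Convexity compares the convex \<open>N\<close> with an affine function. For empty
  \<open>J\<close> the region is an open half-space.\<close>

lemma paraboloid_region:
  fixes e :: "'i \<Rightarrow> 'a::euclidean_space" and p :: 'a
  assumes a: "\<And>i. i \<in> J \<Longrightarrow> a i > 0" and d: "norm d = 1" and ed: "\<And>i. i \<in> J \<Longrightarrow> d \<bullet> e i = 0"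
  defines "N \<equiv> \<lambda>x. \<Sum>i\<in>J. a i * ((x - p) \<bullet> e i)\<^sup>2"
  shows "{x. N x < (x - p) \<bullet> d} \<in> components (UNIV - {x. N x = (x - p) \<bullet> d})"
    and "frontier {x. N x < (x - p) \<bullet> d} = {x. N x = (x - p) \<bullet> d}"
    and "convex {x. N x < (x - p) \<bullet> d}"
proof -
  let ?W = "{x. N x < (x - p) \<bullet> d}" and ?S = "{x. N x = (x - p) \<bullet> d}"
  have cont: "continuous_on UNIV N"
    unfolding N_def by (intro continuous_intros)
  have shift: "N (x + t *\<^sub>R d) = N x" for x t
    unfolding N_def by (intro sum.cong refl) (simp add: ed inner_diff_left inner_add_left)
  have eta: "(x + t *\<^sub>R d - p) \<bullet> d = (x - p) \<bullet> d + t" for x t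
    using d by (simp add: inner_diff_left inner_add_left norm_eq_1)
  show cvx: "convex ?W"
  proof (clarsimp simp: convex_def)
    fix x y and u v :: real
    assume xy: "N x < (x - p) \<bullet> d" "N y < (y - p) \<bullet> d" and uv: "0 \<le> u" "0 \<le> v" "u + v = 1"
    have "N (u *\<^sub>R x + v *\<^sub>R y) \<le> u * N x + v * N y"
      unfolding N_def using a uv by (intro weighted_square_sum_convex) (auto intro: less_imp_le)
    also have "\<dots> < u * ((x - p) \<bullet> d) + v * ((y - p) \<bullet> d)"
    proof (cases "u = 0")
      case False
      then show ?thesis
        using xy uv by (intro add_less_le_mono mult_strict_left_mono mult_left_mono) auto
    qed (use xy uv in auto)
    also have "\<dots> = (u *\<^sub>R x + v *\<^sub>R y - p) \<bullet> d"
    proof -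
      have v: "v = 1 - u" using uv by simp
      show ?thesis unfolding v by (simp add: inner_diff_left inner_add_left algebra_simps)
    qed
    finally show "N (u *\<^sub>R x + v *\<^sub>R y) < (u *\<^sub>R x + v *\<^sub>R y - p) \<bullet> d" .
  qed
  have op: "open ?W"
    using cont by (intro open_Collect_less continuous_intros)
  have ne: "?W \<noteq> {}"
  proof -
    have "N (p + 1 *\<^sub>R d) = 0" unfolding shift by (simp add: N_def)
    then have "p + d \<in> ?W" using eta[of p 1] by simp
    then show ?thesis by blast
  qed
  have cl: "closed (?W \<union> ?S)"
  proof -
    have "?W \<union> ?S = {x. N x \<le> (x - p) \<bullet> d}" by auto
    moreover have "closed {x. N x \<le> (x - p) \<bullet> d}"
      using cont by (intro closed_Collect_le continuous_intros)
    ultimately show ?thesis by simp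
  qed
  have ray: "\<exists>v. \<forall>t. 0 < t \<and> t < 1 \<longrightarrow> x + t *\<^sub>R v \<in> ?W" if "x \<in> ?S" for x
    using that by (intro exI[of _ d]) (auto simp: shift eta)
  show "?W \<in> components (UNIV - ?S)" and "frontier ?W = ?S"
    by (rule region_component_and_frontier[where Q = "?S", OF op cvx ne cl _ _ _ ray]; auto)+
qed

text \<open>Cauchy-Schwarz in the plane for \<open>(sqrt A, sqrt c)\<close> and
  \<open>(sqrt B, sqrt c)\<close>, after bounding \<open>z\<close> by
  \<open>sqrt A * sqrt B\<close>. It controls the mixed term in the convexity proof for a
  hyperboloid sheet.\<close>

lemma mixed_product_bound:
  fixes A B X Y c z :: real
  assumes "A \<ge> 0" "B \<ge> 0" "c \<ge> 0" "X > 0" "Y > 0" "z\<^sup>2 \<le> A * B" "A + c < X\<^sup>2" "B + c < Y\<^sup>2"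
  shows "z + c < X * Y"
proof -
  have z: "\<bar>z\<bar> \<le> sqrt A * sqrt B"
    using assms by (metis real_sqrt_abs real_sqrt_le_iff real_sqrt_mult)
  have "z + c \<le> sqrt A * sqrt B + sqrt c * sqrt c"
    using z assms by simp
  also have "\<dots> \<le> sqrt (A + c) * sqrt (B + c)"
  proof -
    have "(sqrt A * sqrt B + sqrt c * sqrt c)\<^sup>2
      \<le> ((sqrt A)\<^sup>2 + (sqrt c)\<^sup>2) * ((sqrt B)\<^sup>2 + (sqrt c)\<^sup>2)"
      using zero_le_power2[of "sqrt A * sqrt c - sqrt c * sqrt B"]
      by (simp add: power2_eq_square algebra_simps)
    then show ?thesis
      using assms by (simp flip: real_sqrt_mult add: real_le_rsqrt)
  qed
  also have "\<dots> < X * Y"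
  proof (rule mult_strict_mono)
    show "sqrt (A + c) < X" "sqrt (B + c) < Y"
      using assms by (simp_all add: real_less_lsqrt)
  qed (use assms in auto)
  finally show ?thesis .
qed

text \<open>One lemma serves the inside of a hyperboloid sheet (\<open>c > 0\<close>), of a half
  cone (\<open>c = 0\<close>), and half-spaces (\<open>J\<close> empty). The removed set
  \<open>{x. F x = c}\<close> also contains the opposite side; the sign of
  \<open>(x - p) \<bullet> d\<close> selects one. Convexity rests on a reversed Cauchy-Schwarz
  inequality for \<open>F\<close>.\<close>

lemma hyperboloid_region:
  fixes e :: "'i \<Rightarrow> 'a::euclidean_space" and p :: 'a
  assumes a: "\<And>i. i \<in> J \<Longrightarrow> a i > 0" and a0: "a0 > 0" and c: "c \<ge> 0"
    and d: "norm d = 1" and ed: "\<And>i. i \<in> J \<Longrightarrow> d \<bullet> e i = 0"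
  defines "F \<equiv> \<lambda>x. a0 * ((x - p) \<bullet> d)\<^sup>2 - (\<Sum>i\<in>J. a i * ((x - p) \<bullet> e i)\<^sup>2)"
  shows "{x. F x > c \<and> (x - p) \<bullet> d > 0} \<in> components (UNIV - {x. F x = c})"
    and "frontier {x. F x > c \<and> (x - p) \<bullet> d > 0} = {x. F x = c \<and> (x - p) \<bullet> d \<ge> 0}"
    and "convex {x. F x > c \<and> (x - p) \<bullet> d > 0}"
proof -
  let ?W = "{x. F x > c \<and> (x - p) \<bullet> d > 0}" and ?S = "{x. F x = c \<and> (x - p) \<bullet> d \<ge> 0}"
  \<comment> \<open>The polar form of the subtracted squares, needed for the mixed term of a convex
    combination.\<close>
  define N where "N x y = (\<Sum>i\<in>J. a i * ((x - p) \<bullet> e i) * ((y - p) \<bullet> e i))" for x y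
  have F: "F x = a0 * ((x - p) \<bullet> d)\<^sup>2 - N x x" for x
    by (simp add: F_def N_def power2_eq_square mult.assoc)
  have N0: "N x x \<ge> 0" for x
    unfolding N_def using a by (intro sum_nonneg) (simp add: mult.assoc less_imp_le)
  have CS: "(N x y)\<^sup>2 \<le> N x x * N y y" for x y
  proof -
    have "(\<Sum>i\<in>J. (sqrt (a i) * ((x - p) \<bullet> e i)) * (sqrt (a i) * ((y - p) \<bullet> e i)))\<^sup>2
      \<le> (\<Sum>i\<in>J. (sqrt (a i) * ((x - p) \<bullet> e i))\<^sup>2) * (\<Sum>i\<in>J. (sqrt (a i) * ((y - p) \<bullet> e i))\<^sup>2)"
      by (rule Cauchy_Schwarz_ineq_sum)
    also have "(\<Sum>i\<in>J. (sqrt (a i) * ((x - p) \<bullet> e i)) * (sqrt (a i) * ((y - p) \<bullet> e i))) = N x y" for x y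
      unfolding N_def
    proof (intro sum.cong refl)
      fix i assume "i \<in> J"
      then have "sqrt (a i) * sqrt (a i) = a i" using a[of i] by simp
      then show "sqrt (a i) * ((x - p) \<bullet> e i) * (sqrt (a i) * ((y - p) \<bullet> e i))
        = a i * ((x - p) \<bullet> e i) * ((y - p) \<bullet> e i)"
        by (metis (no_types, lifting) mult.assoc mult.left_commute)
    qed
    note this[of x y] this[of x x] this[of y y]
    ultimately show ?thesis
      by (simp add: power2_eq_square)
  qed
  have cont: "continuous_on UNIV F"
    unfolding F_def by (intro continuous_intros)
  have eta: "(x + t *\<^sub>R d - p) \<bullet> d = (x - p) \<bullet> d + t" for x t
    using d by (simp add: inner_diff_left inner_add_left norm_eq_1)
  have shift: "N (x + t *\<^sub>R d) (x + t *\<^sub>R d) = N x x" for x t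
    unfolding N_def by (intro sum.cong refl) (simp add: ed inner_diff_left inner_add_left)
  have up: "F x < F (x + t *\<^sub>R d)" if "(x - p) \<bullet> d \<ge> 0" "t > 0" for x t
  proof -
    have "((x - p) \<bullet> d)\<^sup>2 < ((x - p) \<bullet> d + t)\<^sup>2"
      using that by (intro power_strict_mono) auto
    then show ?thesis
      using a0 by (simp add: F eta shift)
  qed
  show cvx: "convex ?W"
  proof (rule convexI)
    fix x y and u v :: real
    assume "x \<in> ?W" "y \<in> ?W" and uv: "0 \<le> u" "0 \<le> v" "u + v = 1"
    then have xy: "F x > c" "F y > c" "(x - p) \<bullet> d > 0" "(y - p) \<bullet> d > 0"
      by auto
    let ?z = "u *\<^sub>R x + v *\<^sub>R y"
    have comb: "(?z - p) \<bullet> w = u * ((x - p) \<bullet> w) + v * ((y - p) \<bullet> w)" for w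
    proof -
      have v: "v = 1 - u" using uv by simp
      show ?thesis unfolding v by (simp add: inner_diff_left inner_add_left algebra_simps)
    qed
    define X Y where "X = sqrt a0 * ((x - p) \<bullet> d)" and "Y = sqrt a0 * ((y - p) \<bullet> d)"
    have XY: "X\<^sup>2 = a0 * ((x - p) \<bullet> d)\<^sup>2" "Y\<^sup>2 = a0 * ((y - p) \<bullet> d)\<^sup>2"
      using a0 by (simp_all add: X_def Y_def power_mult_distrib)
    have "N x y + c < X * Y"
      using N0 CS xy a0 c by (intro mixed_product_bound[of "N x x" "N y y"])
        (auto simp: XY F, auto simp: X_def Y_def)
    moreover have "N ?z ?z = u\<^sup>2 * N x x + v\<^sup>2 * N y y + 2 * (u * v) * N x y"
      unfolding N_def comb sum_distrib_left sum.distrib[symmetric]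
      by (intro sum.cong refl) (simp add: power2_eq_square algebra_simps)
    moreover have "a0 * ((?z - p) \<bullet> d)\<^sup>2 = u\<^sup>2 * X\<^sup>2 + v\<^sup>2 * Y\<^sup>2 + 2 * (u * v) * (X * Y)"
    proof -
      have "u * X + v * Y = sqrt a0 * ((?z - p) \<bullet> d)"
        unfolding comb X_def Y_def by (simp add: algebra_simps)
      then have "a0 * ((?z - p) \<bullet> d)\<^sup>2 = (u * X + v * Y)\<^sup>2"
        using a0 by (simp add: power_mult_distrib)
      then show ?thesis by (simp add: power2_eq_square algebra_simps)
    qed
    moreover have "c = u\<^sup>2 * c + v\<^sup>2 * c + 2 * (u * v) * c"
    proof -
      have v: "v = 1 - u" using uv by simp
      show ?thesis unfolding v by (simp add: power2_eq_square algebra_simps)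
    qed
    \<comment> \<open>The constant \<open>c\<close> is split according to
      \<open>(u + v)\<^sup>2 = 1\<close>. All three terms are then nonnegative, the mixed one by
      \<open>mixed_product_bound\<close>, and a nonzero weight makes one of the first two
      positive.\<close>
    ultimately have Fz: "F ?z - c = u\<^sup>2 * (F x - c) + v\<^sup>2 * (F y - c) + 2 * (u * v) * (X * Y - N x y - c)"
      by (simp add: F XY algebra_simps)
    have "F ?z - c > 0"
    proof (cases "u = 0")
      case False
      then have "u\<^sup>2 * (F x - c) > 0" "v\<^sup>2 * (F y - c) \<ge> 0"
        using xy by auto
      moreover have "2 * (u * v) * (X * Y - N x y - c) \<ge> 0"
        using uv \<open>N x y + c < X * Y\<close> by simp
      ultimately show ?thesis
        unfolding Fz by linarith
    qed (use uv xy in auto)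
    moreover have "(?z - p) \<bullet> d > 0"
    proof (cases "u = 0")
      case False
      then have "u * ((x - p) \<bullet> d) > 0" "v * ((y - p) \<bullet> d) \<ge> 0"
        using xy uv by auto
      then show ?thesis unfolding comb by linarith
    qed (use uv xy in auto)
    ultimately show "?z \<in> ?W" by simp
  qed
  have op: "open ?W"
    using cont by (intro open_Collect_conj open_Collect_less continuous_intros)
  have ne: "?W \<noteq> {}"
  proof -
    \<comment> \<open>The height on the axis at which \<open>F\<close> equals \<open>c\<close>; one
      unit further up lies inside.\<close>
    define s where "s = sqrt (c / a0)"
    define t where "t = s + 1"
    have "s \<ge> 0" "s\<^sup>2 = c / a0"
      using c a0 by (simp_all add: s_def)
    then have "t > 0" "c / a0 < t\<^sup>2"
      by (simp_all add: t_def power2_sum)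
    then have "p + t *\<^sub>R d \<in> ?W"
      using a0 by (simp only: mem_Collect_eq F eta shift) (simp add: N_def field_simps)
    then show ?thesis by blast
  qed
  have cl: "closed (?W \<union> ?S)"
  proof -
    have "?W \<union> ?S = {x. F x \<ge> c \<and> (x - p) \<bullet> d \<ge> 0}"
    proof -
      \<comment> \<open>As \<open>N\<close> only subtracts, \<open>F x > c \<ge> 0\<close> forces a
        nonzero height, so the weak and the strict sign condition agree off
        \<open>?S\<close>.\<close>
      have "(x - p) \<bullet> d \<noteq> 0" if "F x > c" for x
        using that N0[of x] c by (auto simp: F)
      then show ?thesis by (auto simp: less_le)
    qed
    moreover have "closed {x. F x \<ge> c \<and> (x - p) \<bullet> d \<ge> 0}"
      using cont by (intro closed_Collect_conj closed_Collect_le continuous_intros)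
    ultimately show ?thesis by simp
  qed
  have ray: "\<exists>v. \<forall>t. 0 < t \<and> t < 1 \<longrightarrow> x + t *\<^sub>R v \<in> ?W" if "x \<in> ?S" for x
    using that up by (intro exI[of _ d]) (auto simp: eta)
  show "?W \<in> components (UNIV - {x. F x = c})" and "frontier ?W = ?S"
    by (rule region_component_and_frontier[where Q = "{x. F x = c}", OF op cvx ne cl _ _ _ ray]; auto)+
qed


subsection \<open>Signature of a quadric with a convex component\<close>

text \<open>Far out on a line along which \<open>f\<close> grows quadratically, every segment joining it to a
  parallel line lies in \<open>{f > 0}\<close>; so a convex component containing the line contains the parallel
  line far out in both directions, hence entirely.\<close>

lemma convex_component_with_line:
  fixes f q :: "'a::euclidean_space \<Rightarrow> real" and D :: "'a \<Rightarrow> 'a \<Rightarrow> real"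
  assumes f: "\<And>x t v. f (x + t *\<^sub>R v) = f x + t * D x v + t\<^sup>2 * q v"
    and contD: "\<And>v. continuous_on UNIV (\<lambda>x. D x v)"
    and U: "U \<in> components {x. f x \<noteq> 0}" "convex U" "\<And>x. x \<in> U \<Longrightarrow> f x > 0"
    and u: "u \<in> U" "q v > 0" "D u v = 0"
  shows "{x. f x = 0} = {}"
proof -
  \<comment> \<open>A convex set on which \<open>f\<close> is positive is connected and avoids the
    zeros, so it lies in the component that it meets.\<close>
  have sub: "C \<subseteq> U" if "convex C" "C \<inter> U \<noteq> {}" "\<And>x. x \<in> C \<Longrightarrow> f x > 0" for C
    using components_maximal[OF U(1) convex_connected[OF that(1)]] that by force
  let ?L = "range (\<lambda>t. u + t *\<^sub>R v)"
  have L: "?L \<subseteq> U"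
  proof (rule sub)
    show "convex ?L"
    proof (rule convexI)
      fix x y and a b :: real
      assume "x \<in> ?L" "y \<in> ?L" and ab: "0 \<le> a" "0 \<le> b" "a + b = 1"
      then obtain s t where "x = u + s *\<^sub>R v" "y = u + t *\<^sub>R v"
        by auto
      moreover have "a *\<^sub>R u + b *\<^sub>R u = u"
        using ab by (metis scaleR_add_left scaleR_one)
      ultimately have "a *\<^sub>R x + b *\<^sub>R y = u + (a * s + b * t) *\<^sub>R v"
        by (simp add: algebra_simps)
      then show "a *\<^sub>R x + b *\<^sub>R y \<in> ?L"
        by blast
    qed
    show "?L \<inter> U \<noteq> {}"
    proof -
      have "u \<in> ?L" by (rule range_eqI[of _ _ 0]) simp
      then show ?thesis using u(1) by blast
    qed
    \<comment> \<open>On this line the linear term drops out by \<open>D u v = 0\<close>, leaving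
      \<open>f u + t\<^sup>2 * q v\<close>.\<close>
    show "f x > 0" if "x \<in> ?L" for x
      using that f u U(3)[OF u(1)] by (auto intro!: add_pos_nonneg)
  qed
  have "y \<in> U" for y
  proof -
    \<comment> \<open>With these abbreviations \<open>f\<close> takes the value
      \<open>k s + t * h s + t\<^sup>2 * q v\<close> at \<open>u + s w + t v\<close>, where
      \<open>h\<close> and \<open>k\<close> are bounded for \<open>s\<close> between 0 and
      1.\<close>
    define w where "w = y - u"
    define h where "h s = D (u + s *\<^sub>R w) v" for s
    define k where "k s = f u + s * D u w + s\<^sup>2 * q w" for s
    have "continuous_on {0..1} h"
      unfolding h_def by (intro continuous_on_compose2[OF contD[of v]] continuous_intros) auto
    then have "bounded (h ` {0..1})"
      by (intro compact_imp_bounded compact_continuous_image) auto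
    moreover have "continuous_on {0..1} k"
      unfolding k_def by (intro continuous_intros)
    then have "bounded (k ` {0..1})"
      by (intro compact_imp_bounded compact_continuous_image) auto
    ultimately have "bounded (h ` {0..1} \<union> k ` {0..1})"
      by simp
    then obtain M where M: "M > 0" "\<forall>x \<in> h ` {0..1} \<union> k ` {0..1}. norm x \<le> M"
      unfolding bounded_pos by blast
    \<comment> \<open>Chosen so that \<open>T\<^sup>2 * q v \<ge> T * (2 * M + 1)\<close>, which
      exceeds the bound \<open>M + T * M\<close> on the other two terms; the final summand 1 ensures
      \<open>T \<ge> 1\<close>.\<close>
    define T where "T = (2 * M + 1) / q v + 1"
    have T: "T \<ge> 1" "T * q v \<ge> 2 * M + 1"
      using u M by (auto simp: T_def field_simps)
    have both: "y + t *\<^sub>R v \<in> U" if t: "\<bar>t\<bar> = T" for t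
    proof -
      have "closed_segment (u + t *\<^sub>R v) (y + t *\<^sub>R v) \<subseteq> U"
      proof (rule sub)
        show "closed_segment (u + t *\<^sub>R v) (y + t *\<^sub>R v) \<inter> U \<noteq> {}"
          using L by auto
        fix x assume "x \<in> closed_segment (u + t *\<^sub>R v) (y + t *\<^sub>R v)"
        then obtain s where s: "0 \<le> s" "s \<le> 1" "x = (1 - s) *\<^sub>R (u + t *\<^sub>R v) + s *\<^sub>R (y + t *\<^sub>R v)"
          by (auto simp: closed_segment_def)
        have x: "x = (u + s *\<^sub>R w) + t *\<^sub>R v"
          unfolding s w_def by (simp add: algebra_simps)
        have "\<bar>h s\<bar> \<le> M" "\<bar>k s\<bar> \<le> M"
          using M(2) s by auto
        have "\<bar>t * h s\<bar> \<le> T * M"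
          unfolding abs_mult t using \<open>\<bar>h s\<bar> \<le> M\<close> T by (intro mult_left_mono) auto
        moreover have "t\<^sup>2 * q v \<ge> T * (2 * M + 1)"
        proof -
          have "t\<^sup>2 * q v = T * (T * q v)"
            using t by (metis mult.assoc power2_abs power2_eq_square)
          moreover have "T * (T * q v) \<ge> T * (2 * M + 1)"
            using T by (intro mult_left_mono) auto
          ultimately show ?thesis by linarith
        qed
        moreover have "T * M \<ge> M"
          using T M by simp
        moreover have "T * (2 * M + 1) = T * M + T * M + T"
          by (simp add: algebra_simps)
        ultimately have "k s + t * h s + t\<^sup>2 * q v > 0"
          using \<open>\<bar>k s\<bar> \<le> M\<close> T(1) M(1) by linarith
        then show "f x > 0"
          unfolding x f[of "u + s *\<^sub>R w"] by (simp add: f k_def h_def)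
      qed (rule convex_closed_segment)
      then show ?thesis by auto
    qed
    have "y + T *\<^sub>R v \<in> U" "y + (- T) *\<^sub>R v \<in> U"
      using both[of T] both[of "- T"] T by auto
    then have "(1/2) *\<^sub>R (y + T *\<^sub>R v) + (1/2) *\<^sub>R (y + (- T) *\<^sub>R v) \<in> U"
      using U(2) by (intro convexD) auto
    moreover have "(1/2) *\<^sub>R (y + T *\<^sub>R v) + (1/2) *\<^sub>R (y + (- T) *\<^sub>R v) = y"
      by (simp add: algebra_simps flip: scaleR_left_distrib)
    ultimately show ?thesis by simp
  qed
  then have "f y > 0" for y
    using U(3) by blast
  then show ?thesis
    by (metis (mono_tags, lifting) empty_Collect_eq less_irrefl)
qed

text \<open>At points of \<open>U\<close> the derivative \<open>D\<close> cannot vanish in a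
  direction with \<open>q > 0\<close>, since \<open>convex_component_with_line\<close> would empty
  the zero set. Two positive \<open>l e\<close>, or one together with \<open>b \<noteq> 0\<close>,
  leave enough freedom to build such a direction; one together with \<open>g > 0\<close> would put
  the critical point \<open>p\<close> into \<open>U\<close>.\<close>

lemma convex_component_signs:
  fixes I :: "'a::euclidean_space set" and p b :: 'a and g :: real
  assumes I: "orthonormal I" and l: "\<And>e. e \<in> I \<Longrightarrow> l e \<noteq> 0"
    and b: "\<And>e. e \<in> I \<Longrightarrow> b \<bullet> e = 0" and bg: "b = 0 \<or> g = 0"
  defines "f \<equiv> \<lambda>x. (\<Sum>e\<in>I. l e * ((x - p) \<bullet> e)\<^sup>2) + 2 * ((x - p) \<bullet> b) + g"
  assumes U: "U \<in> components {x. f x \<noteq> 0}" "convex U" "\<And>x. x \<in> U \<Longrightarrow> f x > 0"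
    and ne: "{x. f x = 0} \<noteq> {}"
  obtains (paraboloid) "b \<noteq> 0" "\<And>e. e \<in> I \<Longrightarrow> l e < 0"
  | (ellipsoid) "b = 0" "I \<noteq> {}" "\<And>e. e \<in> I \<Longrightarrow> l e < 0" "g > 0"
  | (hyperboloid) u where "b = 0" "u \<in> I" "l u > 0" "\<And>e. e \<in> I - {u} \<Longrightarrow> l e < 0" "g \<le> 0"
proof -
  \<comment> \<open>\<open>q\<close> is the quadratic part of \<open>f\<close>, and
    \<open>D x v\<close> is the derivative of \<open>f\<close> at \<open>x\<close> in direction
    \<open>v\<close>.\<close>
  define q where "q v = (\<Sum>e\<in>I. l e * (v \<bullet> e)\<^sup>2)" for v
  define D where "D x v = 2 * (\<Sum>e\<in>I. l e * ((x - p) \<bullet> e) * (v \<bullet> e)) + 2 * (v \<bullet> b)" for x v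
  have fin: "finite I"
    using I orthonormal_finite by blast
  have ii: "e \<bullet> e' = (if e = e' then 1 else 0)" if "e \<in> I" "e' \<in> I" for e e'
    using I that unfolding orthonormal_def by blast
  have delta: "(\<Sum>e'\<in>I. c e' * (e \<bullet> e')) = c e" if "e \<in> I" for c e
  proof -
    have "(\<Sum>e'\<in>I. c e' * (e \<bullet> e')) = (\<Sum>e'\<in>I. if e = e' then c e' else 0)"
      using that ii by (intro sum.cong) auto
    then show ?thesis using fin that by simp
  qed
  have expand: "f (x + t *\<^sub>R v) = f x + t * D x v + t\<^sup>2 * q v" for x t v
  proof -
    have "(\<Sum>e\<in>I. l e * ((x + t *\<^sub>R v - p) \<bullet> e)\<^sup>2)
      = (\<Sum>e\<in>I. l e * ((x - p) \<bullet> e)\<^sup>2 + 2 * t * (l e * ((x - p) \<bullet> e) * (v \<bullet> e)) + t\<^sup>2 * (l e * (v \<bullet> e)\<^sup>2))"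
      by (intro sum.cong refl)
        (simp add: inner_diff_left inner_add_left power2_eq_square algebra_simps)
    also have "\<dots> = (\<Sum>e\<in>I. l e * ((x - p) \<bullet> e)\<^sup>2)
        + 2 * t * (\<Sum>e\<in>I. l e * ((x - p) \<bullet> e) * (v \<bullet> e)) + t\<^sup>2 * q v"
      unfolding q_def by (simp only: sum.distrib sum_distrib_left)
    finally show ?thesis
      by (simp add: f_def D_def inner_diff_left inner_add_left distrib_left)
  qed
  have Dlin: "D x (c *\<^sub>R v - d *\<^sub>R w) = c * D x v - d * D x w" for x v w c d
  proof -
    have "(\<Sum>e\<in>I. l e * ((x - p) \<bullet> e) * ((c *\<^sub>R v - d *\<^sub>R w) \<bullet> e))
      = (\<Sum>e\<in>I. c * (l e * ((x - p) \<bullet> e) * (v \<bullet> e)) - d * (l e * ((x - p) \<bullet> e) * (w \<bullet> e)))"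
      by (intro sum.cong refl) (simp add: inner_diff_left algebra_simps)
    also have "\<dots> = c * (\<Sum>e\<in>I. l e * ((x - p) \<bullet> e) * (v \<bullet> e)) - d * (\<Sum>e\<in>I. l e * ((x - p) \<bullet> e) * (w \<bullet> e))"
      by (simp only: sum_subtractf sum_distrib_left)
    finally show ?thesis
      by (simp add: D_def inner_diff_left algebra_simps)
  qed
  have contD: "continuous_on UNIV (\<lambda>x. D x v)" for v
    unfolding D_def by (intro continuous_intros)
  have noline: "D u v \<noteq> 0" if "u \<in> U" "q v > 0" for u v
    using convex_component_with_line[of f D q U u v, OF expand contD U] that ne by blast
  obtain u0 where u0: "u0 \<in> U"
    using U(1) in_components_nonempty by blast
  have De: "D x e = 2 * (l e * ((x - p) \<bullet> e))" if "e \<in> I" for x e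
    using delta[OF that, of "\<lambda>e. l e * ((x - p) \<bullet> e)"] b[OF that]
    by (simp add: D_def inner_commute)
  have qe: "q e = l e" if "e \<in> I" for e
    using delta[OF that, of "\<lambda>e'. l e' * (e \<bullet> e')"] that ii[of e e]
    by (simp add: q_def power2_eq_square mult.assoc)
  show ?thesis
  proof (cases "\<exists>u\<in>I. l u > 0")
    case False
    then have neg: "l e < 0" if "e \<in> I" for e
      using l that by (metis linorder_neqE_linordered_idom)
    show ?thesis
    proof (cases "b = 0")
      case True
      \<comment> \<open>Without positive squares \<open>f \<le> g\<close>, so positivity on
        \<open>U\<close> forces \<open>g > 0\<close>; a nonempty zero set then excludes a constant
        \<open>f\<close>.\<close>
      have "(\<Sum>e\<in>I. l e * ((u0 - p) \<bullet> e)\<^sup>2) \<le> 0"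
        using neg by (intro sum_nonpos) (simp add: mult_nonpos_nonneg less_imp_le)
      then have "g > 0"
        using U(3)[OF u0] True by (simp add: f_def)
      moreover have "I \<noteq> {}"
        using ne True \<open>g > 0\<close> by (auto simp: f_def)
      ultimately show ?thesis
        using True neg ellipsoid by blast
    qed (use neg paraboloid in blast)
  next
    case True
    then obtain u where u: "u \<in> I" "l u > 0" by blast
    have "b = 0"
    proof (rule ccontr)
      assume "b \<noteq> 0"
      \<comment> \<open>Adding a multiple of \<open>b\<close> does not change \<open>q\<close>, as
        \<open>b\<close> is orthogonal to \<open>I\<close>, whereas
        \<open>D u0 b = 2 * (b \<bullet> b)\<close>; the coefficient is the one that makes the
        derivative vanish.\<close>
      define v where "v = u - (D u0 u / (2 * (b \<bullet> b))) *\<^sub>R b"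
      have ve: "v \<bullet> e = u \<bullet> e" if "e \<in> I" for e
        using b[OF that] by (simp add: v_def inner_diff_left)
      have "q v = l u"
        using qe[OF u(1)] ve by (simp add: q_def)
      moreover have "D u0 v = 0"
      proof -
        have "D u0 v = D u0 u - 2 * (u \<bullet> b) + 2 * (v \<bullet> b)"
          using ve by (simp add: D_def)
        also have "\<dots> = 0"
          using \<open>b \<noteq> 0\<close> by (simp add: v_def inner_diff_left)
        finally show ?thesis .
      qed
      ultimately show False
        using noline u0 u by metis
    qed
    have neg: "l e < 0" if e: "e \<in> I - {u}" for e
    proof (rule ccontr)
      assume "\<not> l e < 0"
      then have "l e > 0" using l e by force
      \<comment> \<open>The combination of two positive directions that the linear map
        \<open>D u0\<close> annihilates; \<open>noline\<close> gives
        \<open>D u0 u \<noteq> 0\<close>, so it is not the zero vector.\<close>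
      define v where "v = D u0 e *\<^sub>R u - D u0 u *\<^sub>R e"
      have "D u0 u \<noteq> 0"
        using noline u0 u qe by auto
      have "D u0 v = 0"
        by (simp add: v_def Dlin)
      moreover have "q v = (D u0 e)\<^sup>2 * l u + (D u0 u)\<^sup>2 * l e"
      proof -
        have "q v = (\<Sum>e'\<in>I. (D u0 e)\<^sup>2 * (l e' * (u \<bullet> e')\<^sup>2) + (D u0 u)\<^sup>2 * (l e' * (e \<bullet> e')\<^sup>2))"
          unfolding q_def v_def using ii u e
          by (intro sum.cong refl) (auto simp: inner_diff_left power_mult_distrib)
        then show ?thesis
          using qe u e by (simp add: q_def sum.distrib flip: sum_distrib_left)
      qed
      then have "q v > 0"
        using u \<open>l e > 0\<close> \<open>D u0 u \<noteq> 0\<close> by (simp add: add_nonneg_pos)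
      ultimately show False
        using noline u0 by blast
    qed
    have "g \<le> 0"
    proof (rule ccontr)
      assume g: "\<not> g \<le> 0"
      \<comment> \<open>\<open>f\<close> stays positive when \<open>u0\<close> is moved first to the axis through \<open>p\<close> and then along it to \<open>p\<close>,
        where the gradient vanishes.\<close>
      define x0 where "x0 = p + ((u0 - p) \<bullet> u) *\<^sub>R u"
      have fsplit: "f x = l u * ((x - p) \<bullet> u)\<^sup>2 + (\<Sum>e\<in>I-{u}. l e * ((x - p) \<bullet> e)\<^sup>2) + g" for x
        using fin u \<open>b = 0\<close> by (simp add: f_def sum.remove[of I u])
      have "closed_segment x0 u0 \<subseteq> U"
      proof (rule components_maximal[OF U(1) connected_segment(1)])
        show "closed_segment x0 u0 \<subseteq> {x. f x \<noteq> 0}"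
        proof
          fix x assume "x \<in> closed_segment x0 u0"
          then obtain s where s: "0 \<le> s" "s \<le> 1" "x = (1 - s) *\<^sub>R x0 + s *\<^sub>R u0"
            by (auto simp: closed_segment_def)
          have x: "x - p = (1 - s) *\<^sub>R (((u0 - p) \<bullet> u) *\<^sub>R u) + s *\<^sub>R (u0 - p)"
            unfolding s x0_def by (simp add: algebra_simps)
          have "(x - p) \<bullet> u = (u0 - p) \<bullet> u"
            unfolding x using ii[of u u] u by (simp add: inner_add_left algebra_simps)
          moreover have "(x - p) \<bullet> e = s * ((u0 - p) \<bullet> e)" if "e \<in> I - {u}" for e
            unfolding x inner_add_left inner_scaleR_left using ii[of u e] u that by auto
          then have "(\<Sum>e\<in>I-{u}. l e * ((x - p) \<bullet> e)\<^sup>2) = s\<^sup>2 * (\<Sum>e\<in>I-{u}. l e * ((u0 - p) \<bullet> e)\<^sup>2)"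
            by (simp add: sum_distrib_left power_mult_distrib mult_ac)
          moreover have "s\<^sup>2 * (\<Sum>e\<in>I-{u}. l e * ((u0 - p) \<bullet> e)\<^sup>2) \<ge> (\<Sum>e\<in>I-{u}. l e * ((u0 - p) \<bullet> e)\<^sup>2)"
          proof -
            have "(\<Sum>e\<in>I-{u}. l e * ((u0 - p) \<bullet> e)\<^sup>2) \<le> 0"
              using neg by (intro sum_nonpos) (simp add: mult_nonpos_nonneg less_imp_le)
            moreover have "s\<^sup>2 \<le> 1"
              using s by (simp add: power_le_one)
            ultimately show ?thesis
              using mult_right_mono_neg[of "s\<^sup>2" 1] by simp
          qed
          ultimately have "f x \<ge> f u0"
            unfolding fsplit by simp
          then show "x \<in> {x. f x \<noteq> 0}"
            using U(3)[OF u0] by simp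
        qed
        show "U \<inter> closed_segment x0 u0 \<noteq> {}"
          using u0 by auto
      qed
      then have "x0 \<in> U" by auto
      have "closed_segment p x0 \<subseteq> U"
      proof (rule components_maximal[OF U(1) connected_segment(1)])
        show "closed_segment p x0 \<subseteq> {x. f x \<noteq> 0}"
        proof
          fix x assume "x \<in> closed_segment p x0"
          then obtain s where s: "0 \<le> s" "s \<le> 1" "x = (1 - s) *\<^sub>R p + s *\<^sub>R x0"
            by (auto simp: closed_segment_def)
          have x: "x - p = (s * ((u0 - p) \<bullet> u)) *\<^sub>R u"
            unfolding s x0_def by (simp add: algebra_simps)
          have "(x - p) \<bullet> e = 0" if "e \<in> I - {u}" for e
            unfolding x inner_scaleR_left using ii[of u e] u that by auto
          then have "f x = l u * ((x - p) \<bullet> u)\<^sup>2 + g"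
            unfolding fsplit by simp
          then show "x \<in> {x. f x \<noteq> 0}"
            using u g by (smt (verit) mem_Collect_eq mult_nonneg_nonneg zero_le_power2)
        qed
        show "U \<inter> closed_segment p x0 \<noteq> {}"
          using \<open>x0 \<in> U\<close> by auto
      qed
      then have "p \<in> U" by auto
      moreover have "D p u = 0"
        using De[OF u(1)] by simp
      ultimately show False
        using noline qe u by metis
    qed
    then show ?thesis
      using hyperboloid \<open>b = 0\<close> u neg by blast
  qed
qed


subsection \<open>Normal form and coordinate frames\<close>

text \<open>Diagonalize the symmetrized matrix and complete squares along the eigenvectors with
  nonzero eigenvalue. What remains of the linear part is \<open>v\<close>, orthogonal to them; if it
  is nonzero, shifting \<open>p\<close> along \<open>v\<close> absorbs the constant.\<close>

lemma quadric_normal_form: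
  fixes a :: "'n::finite \<Rightarrow> 'n \<Rightarrow> real" and b :: "'n \<Rightarrow> real" and c :: real
  obtains I l p v g where "orthonormal (I :: (real^'n) set)" "\<And>e. e \<in> I \<Longrightarrow> l e \<noteq> 0"
    "\<And>e. e \<in> I \<Longrightarrow> v \<bullet> e = 0" "v = 0 \<or> g = 0"
    "\<And>x. (\<Sum>i\<in>UNIV. \<Sum>k\<in>UNIV. a i k * x $ i * x $ k) + 2 * (\<Sum>i\<in>UNIV. b i * x $ i) + c
      = (\<Sum>e\<in>I. l e * ((x - p) \<bullet> e)\<^sup>2) + 2 * ((x - p) \<bullet> v) + g"
proof -
  \<comment> \<open>Averaging \<open>a\<close> with its transpose keeps the quadratic form and makes
    \<open>L\<close> self-adjoint.\<close>
  define L where "L x = (\<chi> i. \<Sum>k\<in>UNIV. ((a i k + a k i) / 2) * x $ k)" for x :: "real^'n"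
  have "L = (*v) (\<chi> i k. (a i k + a k i) / 2)"
    by (simp add: L_def fun_eq_iff matrix_vector_mult_def)
  then have "linear L"
    by simp
  have bilin: "x \<bullet> L y = (\<Sum>i\<in>UNIV. \<Sum>k\<in>UNIV. ((a i k + a k i) / 2) * x $ i * y $ k)" for x y
    unfolding inner_vec_def L_def by (simp add: sum_distrib_left mult_ac)
  have sa: "x \<bullet> L y = L x \<bullet> y" for x y
    unfolding inner_commute[of "L x"] bilin
    by (subst sum.swap) (simp add: add.commute mult_ac)
  have form: "x \<bullet> L x = (\<Sum>i\<in>UNIV. \<Sum>k\<in>UNIV. a i k * x $ i * x $ k)" for x
  proof -
    have "x \<bullet> L x = (\<Sum>i\<in>UNIV. \<Sum>k\<in>UNIV. a i k * x $ i * x $ k) / 2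
        + (\<Sum>i\<in>UNIV. \<Sum>k\<in>UNIV. a k i * x $ k * x $ i) / 2"
      unfolding bilin by (simp add: sum_divide_distrib field_simps flip: sum.distrib)
    also have "(\<Sum>i\<in>UNIV. \<Sum>k\<in>UNIV. a k i * x $ k * x $ i) = (\<Sum>i\<in>UNIV. \<Sum>k\<in>UNIV. a i k * x $ i * x $ k)"
      by (rule sum.swap)
    finally show ?thesis by simp
  qed
  define \<beta> where "\<beta> = (\<chi> i. b i)"
  have lin: "(\<Sum>i\<in>UNIV. b i * x $ i) = x \<bullet> \<beta>" for x
    by (simp add: \<beta>_def inner_vec_def mult.commute)
  obtain B l where B: "orthonormal B" and Ll: "\<And>u. u \<in> B \<Longrightarrow> L u = l u *\<^sub>R u"
    and rep: "\<And>x. x = (\<Sum>u\<in>B. (x \<bullet> u) *\<^sub>R u)"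
    using spectral_theorem_selfadjoint[OF \<open>linear L\<close> sa] by metis
  define I where "I = {e\<in>B. l e \<noteq> 0}"
  have finB: "finite B" and on: "orthonormal I" and finI: "finite I" and IB: "I \<subseteq> B"
    using B orthonormal_finite orthonormal_subset[of B I] by (auto simp: I_def)
  have diag: "x \<bullet> L x = (\<Sum>e\<in>I. l e * (x \<bullet> e)\<^sup>2)" for x
  proof -
    have "x \<bullet> L x = (\<Sum>e\<in>B. (x \<bullet> e) * (x \<bullet> L e))"
    proof -
      have "L x = L (\<Sum>e\<in>B. (x \<bullet> e) *\<^sub>R e)"
        using rep[of x] by presburger
      also have "\<dots> = (\<Sum>e\<in>B. (x \<bullet> e) *\<^sub>R L e)"
        by (simp add: linear_sum[OF \<open>linear L\<close>] linear_cmul[OF \<open>linear L\<close>])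
      finally have "x \<bullet> L x = x \<bullet> (\<Sum>e\<in>B. (x \<bullet> e) *\<^sub>R L e)"
        by (rule arg_cong)
      then show ?thesis
        unfolding inner_sum_right inner_scaleR_right .
    qed
    also have "\<dots> = (\<Sum>e\<in>B. l e * (x \<bullet> e)\<^sup>2)"
      by (intro sum.cong refl) (simp add: Ll power2_eq_square)
    also have "\<dots> = (\<Sum>e\<in>I. l e * (x \<bullet> e)\<^sup>2)"
      using finB by (intro sum.mono_neutral_right) (auto simp: I_def)
    finally show ?thesis .
  qed
  \<comment> \<open>\<open>bI\<close> is the part of the linear term in the span of
    \<open>I\<close>, removed by centring at \<open>p0\<close>; \<open>C\<close> is the constant
    that completing the squares produces.\<close>
  define bI v p0 C where "bI = (\<Sum>e\<in>I. (\<beta> \<bullet> e) *\<^sub>R e)" and "v = \<beta> - bI"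
    and "p0 = (\<Sum>e\<in>I. (- (\<beta> \<bullet> e) / l e) *\<^sub>R e)" and "C = (\<Sum>e\<in>I. (\<beta> \<bullet> e)\<^sup>2 / l e)"
  \<comment> \<open>The multiple of \<open>v\<close> is fitted to give
    \<open>2 * (p \<bullet> v) = C - c\<close> when \<open>v \<noteq> 0\<close>. For
    \<open>v = 0\<close> the added term is 0 and \<open>p = p0\<close>.\<close>
  define p where "p = p0 + ((C - c) / (2 * (v \<bullet> v))) *\<^sub>R v"
  have v: "v \<bullet> e = 0" if "e \<in> I" for e
    using inner_sum_orthonormal[OF on order_refl that] that by (simp add: v_def bI_def inner_diff_left)
  have pe: "p \<bullet> e = - (\<beta> \<bullet> e) / l e" if "e \<in> I" for e
    using inner_sum_orthonormal[OF on order_refl that] that v[OF that]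
    by (simp add: p_def p0_def inner_add_left del: scaleR_minus_left)
  have "p0 \<bullet> v = 0"
    unfolding p0_def inner_sum_left using v by (intro sum.neutral) (simp add: inner_commute)
  then have pv: "2 * (p \<bullet> v) = C - c" if "v \<noteq> 0"
    using that by (simp add: p_def inner_add_left)
  show ?thesis
  proof (rule that[of I l v "c - C + 2 * (p \<bullet> v)" p])
    show "v = 0 \<or> c - C + 2 * (p \<bullet> v) = 0"
      using pv by (cases "v = 0") simp_all
    fix x
    have "(\<Sum>e\<in>I. l e * ((x - p) \<bullet> e)\<^sup>2)
      = (\<Sum>e\<in>I. l e * (x \<bullet> e)\<^sup>2 + 2 * ((\<beta> \<bullet> e) * (x \<bullet> e)) + (\<beta> \<bullet> e)\<^sup>2 / l e)"
    proof (intro sum.cong refl)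
      fix e assume e: "e \<in> I"
      then have "l e \<noteq> 0" by (simp add: I_def)
      then show "l e * ((x - p) \<bullet> e)\<^sup>2 = l e * (x \<bullet> e)\<^sup>2 + 2 * ((\<beta> \<bullet> e) * (x \<bullet> e)) + (\<beta> \<bullet> e)\<^sup>2 / l e"
        by (simp add: inner_diff_left pe[OF e] power2_eq_square field_simps)
    qed
    also have "\<dots> = x \<bullet> L x + 2 * (x \<bullet> bI) + C"
      by (simp add: diag bI_def C_def inner_sum_right sum.distrib sum_distrib_left)
    finally show "(\<Sum>i\<in>UNIV. \<Sum>k\<in>UNIV. a i k * x $ i * x $ k) + 2 * (\<Sum>i\<in>UNIV. b i * x $ i) + c
      = (\<Sum>e\<in>I. l e * ((x - p) \<bullet> e)\<^sup>2) + 2 * ((x - p) \<bullet> v) + (c - C + 2 * (p \<bullet> v))"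
      unfolding form[symmetric] lin by (simp add: v_def inner_diff_left inner_diff_right)
  qed (use on v in \<open>auto simp: I_def\<close>)
qed

text \<open>Multiplying out in standard coordinates gives the coefficients; the value at
  \<open>w\<close> shows that the quadratic ones do not all vanish.\<close>

lemma quadric_surface_sum_squares:
  fixes e :: "'i \<Rightarrow> real^'n" and p d :: "real^'n"
  assumes ne: "(\<Sum>i\<in>J. a i * (w \<bullet> e i)\<^sup>2) \<noteq> 0"
  shows "quadric_surface {x. (\<Sum>i\<in>J. a i * ((x - p) \<bullet> e i)\<^sup>2) + (x - p) \<bullet> d + g = 0}"
proof -
  define A where "A j k = (\<Sum>i\<in>J. a i * e i $ j * e i $ k)" for j k
  \<comment> \<open>Half of \<open>d\<close>, because the linear part in
    \<open>quadric_surface_def\<close> carries a factor 2.\<close>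
  define b where "b = (1/2) *\<^sub>R d - (\<Sum>i\<in>J. (a i * (p \<bullet> e i)) *\<^sub>R e i)"
  define c where "c = (\<Sum>i\<in>J. a i * (p \<bullet> e i)\<^sup>2) - p \<bullet> d + g"
  have form: "(\<Sum>j\<in>UNIV. \<Sum>k\<in>UNIV. A j k * x $ j * x $ k) = (\<Sum>i\<in>J. a i * (x \<bullet> e i)\<^sup>2)" for x
  proof -
    have "(\<Sum>j\<in>UNIV. \<Sum>k\<in>UNIV. A j k * x $ j * x $ k)
      = (\<Sum>j\<in>UNIV. \<Sum>k\<in>UNIV. \<Sum>i\<in>J. a i * ((x $ j * e i $ j) * (x $ k * e i $ k)))"
      unfolding A_def sum_distrib_right by (intro sum.cong refl) (simp add: mult_ac)
    also have "\<dots> = (\<Sum>j\<in>UNIV. \<Sum>i\<in>J. \<Sum>k\<in>UNIV. a i * ((x $ j * e i $ j) * (x $ k * e i $ k)))"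
      by (intro sum.cong refl sum.swap)
    also have "\<dots> = (\<Sum>i\<in>J. \<Sum>j\<in>UNIV. \<Sum>k\<in>UNIV. a i * ((x $ j * e i $ j) * (x $ k * e i $ k)))"
      by (rule sum.swap)
    also have "\<dots> = (\<Sum>i\<in>J. a i * (x \<bullet> e i)\<^sup>2)"
      unfolding inner_vec_def inner_real_def power2_eq_square sum_product by (simp add: sum_distrib_left)
    finally show ?thesis .
  qed
  have "\<exists>j k. A j k \<noteq> 0"
  proof (rule ccontr)
    assume "\<not> ?thesis"
    then show False
      using form[of w] ne by simp
  qed
  moreover have "(\<Sum>i\<in>J. a i * ((x - p) \<bullet> e i)\<^sup>2) + (x - p) \<bullet> d + g
    = (\<Sum>j\<in>UNIV. \<Sum>k\<in>UNIV. A j k * x $ j * x $ k) + 2 * (\<Sum>j\<in>UNIV. b $ j * x $ j) + c" for x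
  proof -
    have "(\<Sum>j\<in>UNIV. b $ j * x $ j) = b \<bullet> x"
      by (simp add: inner_vec_def)
    moreover have "b \<bullet> x = (x \<bullet> d) / 2 - (\<Sum>i\<in>J. a i * (p \<bullet> e i) * (x \<bullet> e i))"
      unfolding inner_commute[of b] by (simp add: b_def inner_diff_right inner_sum_right inner_commute)
    moreover have "(\<Sum>i\<in>J. a i * ((x - p) \<bullet> e i)\<^sup>2)
      = (\<Sum>i\<in>J. a i * (x \<bullet> e i)\<^sup>2 - 2 * (a i * (p \<bullet> e i) * (x \<bullet> e i)) + a i * (p \<bullet> e i)\<^sup>2)"
      by (intro sum.cong refl) (simp add: inner_diff_left power2_eq_square algebra_simps)
    moreover have "\<dots> = (\<Sum>i\<in>J. a i * (x \<bullet> e i)\<^sup>2) - 2 * (\<Sum>i\<in>J. a i * (p \<bullet> e i) * (x \<bullet> e i))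
      + (\<Sum>i\<in>J. a i * (p \<bullet> e i)\<^sup>2)"
      by (simp only: sum.distrib sum_subtractf sum_distrib_left)
    ultimately show ?thesis
      unfolding form by (simp add: c_def inner_diff_left)
  qed
  ultimately show ?thesis
    unfolding quadric_surface_def
    by (intro exI[of _ A] exI[of _ "\<lambda>j. b $ j"] exI[of _ c]) simp
qed

text \<open>An orthonormal basis \<open>C\<close> of the orthogonal complement completes
  \<open>A \<union> B\<close>, and the three blocks are numbered consecutively. Two prescribed
  blocks allow a distinguished vector to precede the others (hyperboloid) or to follow them
  (paraboloid).\<close>

lemma orthonormal_frame_extending:
  fixes A B :: "(real^'n) set"
  assumes on: "orthonormal (A \<union> B)" and disj: "A \<inter> B = {}"
  obtains e where "orthonormal_frame e" "bij_betw e {1..card A} A"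
    "bij_betw e {card A + 1..card A + card B} B" "card A + card B \<le> CARD('n)"
proof -
  define V where "V = {x. \<forall>u\<in>A \<union> B. x \<bullet> u = 0}"
  have "subspace V"
    by (auto simp: V_def subspace_def inner_add_left)
  then obtain C where C: "C \<subseteq> V" "pairwise orthogonal C" "\<And>x. x \<in> C \<Longrightarrow> norm x = 1" "span C = V"
    using orthonormal_basis_subspace by metis
  let ?M = "A \<union> B \<union> C"
  have onC: "orthonormal C"
    using C by (simp add: orthonormal_iff)
  have mixed: "u \<bullet> v = 0" "v \<bullet> u = 0" "u \<noteq> v" if "u \<in> A \<union> B" "v \<in> C" for u v
  proof -
    show "v \<bullet> u = 0" using that C(1) by (auto simp: V_def)
    then show "u \<bullet> v = 0" by (simp add: inner_commute)
    then show "u \<noteq> v" using C(3)[OF that(2)] by (auto simp: norm_eq_1)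
  qed
  have M: "orthonormal ?M"
    unfolding orthonormal_def
  proof (intro ballI)
    fix u v assume "u \<in> ?M" "v \<in> ?M"
    then consider "u \<in> A \<union> B" "v \<in> A \<union> B" | "u \<in> A \<union> B" "v \<in> C" | "u \<in> C" "v \<in> A \<union> B" | "u \<in> C" "v \<in> C"
      by blast
    then show "u \<bullet> v = (if u = v then 1 else 0)"
    proof cases
      case 1 then show ?thesis using on unfolding orthonormal_def by blast
    next
      case 2 then show ?thesis using mixed[of u v] by simp
    next
      case 3 then show ?thesis using mixed[of v u] by auto
    next
      case 4 then show ?thesis using onC unfolding orthonormal_def by blast
    qed
  qed
  have fin: "finite A" "finite B" "finite C"
    using orthonormal_finite[OF M] by auto
  have disjC: "(A \<union> B) \<inter> C = {}"
    using mixed(3) by blast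
  \<comment> \<open>Projecting onto the span of \<open>A \<union> B\<close> leaves a remainder in
    \<open>V\<close>, so \<open>?M\<close> spans the space and its cardinality is the
    dimension.\<close>
  have "x \<in> span ?M" for x
  proof -
    let ?y = "\<Sum>u\<in>A \<union> B. (x \<bullet> u) *\<^sub>R u"
    have "x - ?y \<in> V"
      using inner_sum_orthonormal[OF on order_refl] by (auto simp: V_def inner_diff_left)
    then have "x - ?y \<in> span ?M"
      using C(4) span_mono[of C ?M] by auto
    moreover have "?y \<in> span ?M"
      by (intro span_sum span_scale span_base) auto
    ultimately show ?thesis
      using span_add[of "x - ?y" ?M ?y] by simp
  qed
  then have "CARD('n) \<le> card ?M"
    using dim_le_card[of UNIV ?M] fin by (auto simp: dim_UNIV)
  then have card: "card ?M = CARD('n)"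
    using orthonormal_card_le[OF M] by simp
  have cardM: "card ?M = card A + card B + card C"
    using fin disj disjC by (simp add: card_Un_disjoint Int_Un_distrib2)
  obtain fA where fA: "bij_betw fA {1..card A} A"
    using ex_bij_betw_nat_finite_1[OF fin(1)] by blast
  obtain fB where fB: "bij_betw fB {1..card B} B"
    using ex_bij_betw_nat_finite_1[OF fin(2)] by blast
  obtain fC where fC: "bij_betw fC {1..card C} C"
    using ex_bij_betw_nat_finite_1[OF fin(3)] by blast
  \<comment> \<open>Each block is enumerated from 1, so the sizes of the earlier blocks are
    subtracted from the position.\<close>
  define e where "e i = (if i \<le> card A then fA i else if i \<le> card A + card B then fB (i - card A)
    else fC (i - (card A + card B)))" for i
  have shift: "bij_betw (\<lambda>i. i - m) {m + 1..m + k} {1..k}" for m k :: nat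
    by (rule bij_betw_byWitness[where f' = "\<lambda>i. i + m"]) auto
  have eA: "bij_betw e {1..card A} A"
    using fA by (subst bij_betw_cong[of _ _ fA]) (auto simp: e_def)
  have eB: "bij_betw e {card A + 1..card A + card B} B"
    using bij_betw_trans[OF shift fB, of "card A"]
    by (subst bij_betw_cong[of _ _ "fB \<circ> (\<lambda>i. i - card A)"]) (auto simp: e_def)
  have eC: "bij_betw e {card A + card B + 1..card A + card B + card C} C"
    using bij_betw_trans[OF shift fC, of "card A + card B"]
    by (subst bij_betw_cong[of _ _ "fC \<circ> (\<lambda>i. i - (card A + card B))"]) (auto simp: e_def)
  have "bij_betw e ({1..card A} \<union> {card A + 1..card A + card B}) (A \<union> B)"
    using eA eB disj by (rule bij_betw_combine)
  then have "bij_betw e ({1..card A} \<union> {card A + 1..card A + card B}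
      \<union> {card A + card B + 1..card A + card B + card C}) ?M"
    using eC disjC by (rule bij_betw_combine)
  moreover have "{1..card A} \<union> {card A + 1..card A + card B}
      \<union> {card A + card B + 1..card A + card B + card C} = {1..CARD('n)}"
    using card cardM by auto
  ultimately have e: "bij_betw e {1..CARD('n)} ?M"
    by simp
  have "orthonormal_frame e"
    unfolding orthonormal_frame_def
  proof (intro ballI)
    fix i j assume ij: "i \<in> {1..CARD('n)}" "j \<in> {1..CARD('n)}"
    then have "e i \<in> ?M" "e j \<in> ?M" "e i = e j \<longleftrightarrow> i = j"
      using e unfolding bij_betw_def by (blast, blast, meson inj_onD)
    then show "e i \<bullet> e j = (if i = j then 1 else 0)"
      using M unfolding orthonormal_def by metis
  qed
  then show ?thesis
    using that eA eB card cardM by simp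
qed


subsection \<open>Classification\<close>

text \<open>Full dimension excludes the empty set, and only the empty set and the whole space have
  empty frontier.\<close>

lemma convex_surface_nonempty:
  assumes "convex_surface S" shows "S \<noteq> {}"
proof -
  obtain K where K: "aff_dim K = int CARD('a)" "K \<noteq> UNIV" "S = frontier (K :: (real^'a) set)"
    using assms unfolding convex_surface_def by blast
  then have "K \<noteq> {}" by (auto simp: aff_dim_empty)
  then show ?thesis
    using K frontier_eq_empty by blast
qed

lemma convex_quadricI:
  assumes "convex_surface S" "quadric_surface Q" "S \<subseteq> Q"
    and "U \<in> components (UNIV - Q)" "frontier U = S" "convex U"
  shows "convex_quadric S"
proof -
  have "Q \<noteq> {}"
    using convex_surface_nonempty[OF assms(1)] assms(3) by blast
  then show ?thesis
    using assms unfolding convex_quadric_def real_quadric_surface_def by blast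
qed

text \<open>A frame-free classification. The signature of the normal form determines a model region
  that meets \<open>U\<close>; both are components of the complement of \<open>Q\<close>, so they
  coincide and \<open>S\<close> is the known frontier. Empty \<open>J\<close> in the last two cases
  accounts for hyperplanes.\<close>

lemma convex_quadric_cases:
  fixes S :: "(real^'n) set"
  assumes "convex_quadric S"
  obtains (ellipsoid) J a p where "orthonormal J" "J \<noteq> {}" "\<And>e. e \<in> J \<Longrightarrow> a e > 0"
      "S = {x. (\<Sum>e\<in>J. a e * ((x - p) \<bullet> e)\<^sup>2) = 1}"
  | (hyperboloid) J u a c p where "orthonormal (insert u J)" "u \<notin> J" "\<And>e. e \<in> insert u J \<Longrightarrow> a e > 0"
      "c = 0 \<or> c = 1"
      "S = {x. a u * ((x - p) \<bullet> u)\<^sup>2 - (\<Sum>e\<in>J. a e * ((x - p) \<bullet> e)\<^sup>2) = c \<and> (x - p) \<bullet> u \<ge> 0}"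
  | (paraboloid) J d a p where "orthonormal (insert d J)" "d \<notin> J" "\<And>e. e \<in> J \<Longrightarrow> a e > 0"
      "S = {x. (\<Sum>e\<in>J. a e * ((x - p) \<bullet> e)\<^sup>2) = (x - p) \<bullet> d}"
proof -
  obtain Q U where Q: "quadric_surface Q" "Q \<noteq> {}" and U: "U \<in> components (UNIV - Q)" "convex U"
    and S: "S = frontier U"
    using assms unfolding convex_quadric_def real_quadric_surface_def by blast
  obtain a0 b0 c0 where Q0: "Q = {x. (\<Sum>i\<in>UNIV. \<Sum>k\<in>UNIV. a0 i k * x $ i * x $ k)
      + 2 * (\<Sum>i\<in>UNIV. b0 i * x $ i) + c0 = 0}"
    using Q(1) unfolding quadric_surface_def by blast
  obtain I l p v g where nf0: "orthonormal (I :: (real^'n) set)" "\<And>e. e \<in> I \<Longrightarrow> l e \<noteq> 0"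
    "\<And>e. e \<in> I \<Longrightarrow> v \<bullet> e = 0" "v = 0 \<or> g = 0"
    "\<And>x. (\<Sum>i\<in>UNIV. \<Sum>k\<in>UNIV. a0 i k * x $ i * x $ k) + 2 * (\<Sum>i\<in>UNIV. b0 i * x $ i) + c0
      = (\<Sum>e\<in>I. l e * ((x - p) \<bullet> e)\<^sup>2) + 2 * ((x - p) \<bullet> v) + g"
    by (rule quadric_normal_form[of a0 b0 c0]) (rule that; assumption)
  define F where "F l v g x = (\<Sum>e\<in>I. l e * ((x - p) \<bullet> e)\<^sup>2) + 2 * ((x - p) \<bullet> v) + g"
    for l :: "real^'n \<Rightarrow> real" and v g x
  have QF0: "Q = {x. F l v g x = 0}"
    unfolding Q0 nf0(5) F_def ..
  have Une: "U \<noteq> {}" and UQ: "U \<inter> Q = {}"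
    using U in_components_nonempty in_components_subset by blast+
  have F_neg: "F (\<lambda>e. - l e) (- v) (- g) x = - F l v g x" for x
    by (simp add: F_def sum_negf)
  \<comment> \<open>\<open>F\<close> has no zero on the connected set \<open>U\<close>, hence a
    constant sign there; if it is negative, all coefficients are negated.\<close>
  obtain l v g where nf: "\<And>e. e \<in> I \<Longrightarrow> l e \<noteq> 0" "\<And>e. e \<in> I \<Longrightarrow> v \<bullet> e = 0" "v = 0 \<or> g = 0"
    and QF: "Q = {x. F l v g x = 0}" and pos: "\<And>x. x \<in> U \<Longrightarrow> F l v g x > 0"
  proof (cases "\<exists>x\<in>U. F l v g x > 0")
    case True
    have "F l v g x > 0" if "x \<in> U" for x
    proof (rule ccontr)
      assume "\<not> F l v g x > 0"
      moreover obtain y where "y \<in> U" "F l v g y > 0"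
        using True by blast
      moreover have "continuous_on U (F l v g)"
        unfolding F_def by (intro continuous_intros)
      then have "connected (F l v g ` U)"
        using U(2) connected_continuous_image convex_connected by blast
      ultimately have "0 \<in> F l v g ` U"
        using connectedD_interval[of "F l v g ` U" "F l v g x" "F l v g y" 0] \<open>x \<in> U\<close> by auto
      then show False
        using UQ QF0 by auto
    qed
    then show ?thesis
      using that[OF nf0(2,3,4) QF0] by simp
  next
    case False
    then have "F l v g x < 0" if "x \<in> U" for x
      using UQ QF0 that by (metis (mono_tags, lifting) disjoint_iff linorder_neqE_linordered_idom mem_Collect_eq)
    then show ?thesis
      using that[of "\<lambda>e. - l e" "- v" "- g"] nf0 QF0 by (simp add: F_neg)
  qed
  have UF: "U \<in> components {x. F l v g x \<noteq> 0}"
    using U(1) unfolding QF by (simp add: set_diff_eq)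
  have ne: "{x. F l v g x = 0} \<noteq> {}"
    using Q(2) QF by simp
  show ?thesis
  proof (rule convex_component_signs[where I = I and l = l and b = v and g = g and p = p and U = U,
        folded F_def])
    show "orthonormal I" "\<And>e. e \<in> I \<Longrightarrow> l e \<noteq> 0" "\<And>e. e \<in> I \<Longrightarrow> v \<bullet> e = 0" "v = 0 \<or> g = 0"
      "U \<in> components {x. F l v g x \<noteq> 0}" "convex U" "\<And>x. x \<in> U \<Longrightarrow> F l v g x > 0"
      "{x. F l v g x = 0} \<noteq> {}"
      by (fact nf0(1) nf UF U(2) pos ne)+
  next
    assume 1: "v \<noteq> 0" "\<And>e. e \<in> I \<Longrightarrow> l e < 0"
    \<comment> \<open>Dividing by \<open>2 * norm v\<close> gives the linear part coefficient 1
      along the unit vector \<open>d\<close>.\<close>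
    define d where "d = v /\<^sub>R norm v"
    define a where "a e = - l e / (2 * norm v)" for e
    have d: "norm d = 1" "\<And>e. e \<in> I \<Longrightarrow> d \<bullet> e = 0" "v = norm v *\<^sub>R d"
      using 1 nf(2) by (simp_all add: d_def)
    have a: "a e > 0" if "e \<in> I" for e
      using 1 that by (simp add: a_def divide_neg_pos)
    have F: "F l v g x = 2 * norm v * ((x - p) \<bullet> d - (\<Sum>e\<in>I. a e * ((x - p) \<bullet> e)\<^sup>2))" for x
    proof -
      have "2 * norm v * (\<Sum>e\<in>I. a e * ((x - p) \<bullet> e)\<^sup>2) = - (\<Sum>e\<in>I. l e * ((x - p) \<bullet> e)\<^sup>2)"
        unfolding sum_distrib_left sum_negf[symmetric]
        using 1 by (intro sum.cong refl) (simp add: a_def)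
      moreover have "(x - p) \<bullet> v = norm v * ((x - p) \<bullet> d)"
        using d(3) by (metis inner_scaleR_right)
      ultimately show ?thesis
        using nf(3) 1 by (simp add: F_def right_diff_distrib)
    qed
    define W where "W = {x. (\<Sum>e\<in>I. a e * ((x - p) \<bullet> e)\<^sup>2) < (x - p) \<bullet> d}"
    have Q': "Q = {x. (\<Sum>e\<in>I. a e * ((x - p) \<bullet> e)\<^sup>2) = (x - p) \<bullet> d}"
      using 1 by (auto simp: QF F)
    have W: "W \<in> components (UNIV - Q)" "frontier W = Q"
      unfolding W_def Q' using paraboloid_region[of I a d "\<lambda>e. e" p, OF a d(1,2)] by auto
    have "U \<subseteq> W"
      using pos 1 by (auto simp: F W_def zero_less_mult_iff)
    then have "U = W"
      using components_nonoverlap[OF U(1) W(1)] Une by blast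
    then have "S = {x. (\<Sum>e\<in>I. a e * ((x - p) \<bullet> e)\<^sup>2) = (x - p) \<bullet> d}"
      using S W Q' by simp
    moreover have "orthonormal (insert d I)"
      using d nf0(1) by (intro orthonormal_insert) auto
    moreover have "d \<notin> I"
      using d by (auto simp: norm_eq_1)
    ultimately show ?thesis
      using a by (intro paraboloid[of d I a p])
  next
    assume 2: "v = 0" "I \<noteq> {}" "\<And>e. e \<in> I \<Longrightarrow> l e < 0" "g > 0"
    define a where "a e = - l e / g" for e
    have a: "a e > 0" if "e \<in> I" for e
      using 2 that by (simp add: a_def divide_neg_pos)
    have F: "F l v g x = g * (1 - (\<Sum>e\<in>I. a e * ((x - p) \<bullet> e)\<^sup>2))" for x
    proof -
      have "g * (\<Sum>e\<in>I. a e * ((x - p) \<bullet> e)\<^sup>2) = - (\<Sum>e\<in>I. l e * ((x - p) \<bullet> e)\<^sup>2)"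
        unfolding sum_distrib_left sum_negf[symmetric]
        using 2 by (intro sum.cong refl) (simp add: a_def)
      then show ?thesis
        using 2 by (simp add: F_def right_diff_distrib)
    qed
    define W where "W = {x. (\<Sum>e\<in>I. a e * ((x - p) \<bullet> e)\<^sup>2) < 1}"
    have Q': "Q = {x. (\<Sum>e\<in>I. a e * ((x - p) \<bullet> e)\<^sup>2) = 1}"
      using 2(4) by (auto simp: QF F)
    have W: "W \<in> components (UNIV - Q)" "frontier W = Q"
      unfolding W_def Q' using ellipsoid_region[of I a p "\<lambda>e. e", OF a] by auto
    have "U \<subseteq> W"
      using pos 2(4) by (auto simp: F W_def zero_less_mult_iff)
    then have "U = W"
      using components_nonoverlap[OF U(1) W(1)] Une by blast
    then have "S = {x. (\<Sum>e\<in>I. a e * ((x - p) \<bullet> e)\<^sup>2) = 1}"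
      using S W Q' by simp
    then show ?thesis
      using a 2 nf0(1) by (intro ellipsoid[of I a p])
  next
    fix u
    assume 3: "v = 0" "u \<in> I" "l u > 0" "\<And>e. e \<in> I - {u} \<Longrightarrow> l e < 0" "g \<le> 0"
    define J where "J = I - {u}"
    \<comment> \<open>Scaling by \<open>- g\<close> turns a nonzero constant into
      \<open>c = 1\<close>; for \<open>g = 0\<close> the scale is 1 and
      \<open>c = 0\<close>.\<close>
    define m where "m = (if g = 0 then 1 else - g)"
    define c :: real where "c = (if g = 0 then 0 else 1)"
    have m: "m > 0" "g = - (m * c)" and c: "c = 0 \<or> c = 1" "c \<ge> 0"
      using 3 by (auto simp: m_def c_def)
    have ii: "e \<bullet> e' = (if e = e' then 1 else 0)" if "e \<in> I" "e' \<in> I" for e e'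
      using nf0(1) that unfolding orthonormal_def by blast
    obtain x0 where x0: "x0 \<in> U"
      using Une by blast
    \<comment> \<open>Orients \<open>d\<close> as \<open>u\<close> or \<open>- u\<close> so that
      \<open>x0\<close> gets positive height. Height 0 falls under \<open>-1\<close> here, but is
      excluded below by \<open>G x0 > c \<ge> 0\<close>.\<close>
    define s :: real where "s = (if (x0 - p) \<bullet> u > 0 then 1 else -1)"
    define d where "d = s *\<^sub>R u"
    have dsq: "((x - p) \<bullet> u)\<^sup>2 = ((x - p) \<bullet> d)\<^sup>2" for x
      by (simp add: d_def s_def)
    have d: "norm d = 1" "\<And>e. e \<in> J \<Longrightarrow> d \<bullet> e = 0"
      using ii[of u] 3 by (auto simp: d_def s_def J_def norm_eq_1)
    have "d \<notin> J"
      using d by (auto simp: norm_eq_1)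
    define a where "a e = (if e = d then l u / m else - l e / m)" for e
    have a: "a e > 0" if "e \<in> insert d J" for e
      using 3 m that \<open>d \<notin> J\<close> by (auto simp: a_def J_def divide_neg_pos)
    define G where "G x = a d * ((x - p) \<bullet> d)\<^sup>2 - (\<Sum>e\<in>J. a e * ((x - p) \<bullet> e)\<^sup>2)" for x
    have F: "F l v g x = m * (G x - c)" for x
    proof -
      have "m * (\<Sum>e\<in>J. a e * ((x - p) \<bullet> e)\<^sup>2) = - (\<Sum>e\<in>J. l e * ((x - p) \<bullet> e)\<^sup>2)"
        unfolding sum_distrib_left sum_negf[symmetric]
        using m \<open>d \<notin> J\<close> by (intro sum.cong refl) (auto simp: a_def)
      moreover have "F l v g x = l u * ((x - p) \<bullet> u)\<^sup>2 + (\<Sum>e\<in>J. l e * ((x - p) \<bullet> e)\<^sup>2) + g"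
        using orthonormal_finite[OF nf0(1)] 3 by (simp add: F_def J_def sum.remove[of I u])
      moreover have "m * (a d * ((x - p) \<bullet> d)\<^sup>2) = l u * ((x - p) \<bullet> u)\<^sup>2"
        using m by (simp add: a_def dsq)
      ultimately show ?thesis
        using m by (simp add: G_def right_diff_distrib)
    qed
    define W where "W = {x. G x > c \<and> (x - p) \<bullet> d > 0}"
    have Q': "Q = {x. G x = c}"
      using m(1) by (auto simp: QF F)
    have aJ: "a e > 0" if "e \<in> J" for e
      using a that by blast
    have W: "W \<in> components (UNIV - Q)" "frontier W = {x. G x = c \<and> (x - p) \<bullet> d \<ge> 0}"
      unfolding W_def Q' G_def
      using hyperboloid_region[of J a "a d" c d "\<lambda>e. e" p, OF aJ _ c(2) d] a by auto
    have "x0 \<in> W"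
    proof -
      have "G x0 > c"
        using pos[OF x0] m(1) by (simp add: F zero_less_mult_iff)
      moreover have "(\<Sum>e\<in>J. a e * ((x0 - p) \<bullet> e)\<^sup>2) \<ge> 0"
        using aJ by (intro sum_nonneg) (simp add: less_imp_le)
      ultimately have "(x0 - p) \<bullet> d \<noteq> 0"
        using c by (auto simp: G_def)
      then have "(x0 - p) \<bullet> d > 0"
        by (auto simp: d_def s_def split: if_splits)
      with \<open>G x0 > c\<close> show ?thesis
        by (simp add: W_def)
    qed
    then have "U = W"
      using components_nonoverlap[OF U(1) W(1)] x0 by blast
    then have "S = {x. a d * ((x - p) \<bullet> d)\<^sup>2 - (\<Sum>e\<in>J. a e * ((x - p) \<bullet> e)\<^sup>2) = c \<and> (x - p) \<bullet> d \<ge> 0}"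
      using S W by (simp add: G_def)
    moreover have "orthonormal (insert d J)"
      using d orthonormal_subset[OF nf0(1), of J] by (intro orthonormal_insert) (auto simp: J_def)
    ultimately show ?thesis
      using \<open>d \<notin> J\<close> a c(1) by (intro hyperboloid[of d J a c p])
  qed
qed


section \<open>From the listed equations to convex quadrics\<close>

lemma frame_inner:
  assumes "orthonormal_frame (e :: nat \<Rightarrow> real^'n)" "1 \<le> i" "i \<le> CARD('n)" "1 \<le> j" "j \<le> CARD('n)"
  shows "e i \<bullet> e j = (if i = j then 1 else 0)"
  using assms unfolding orthonormal_frame_def by auto

lemma sum_delta_frame:
  fixes e :: "nat \<Rightarrow> real^'n"
  assumes "orthonormal_frame e" "m \<in> J" "J \<subseteq> {1..CARD('n)}"
  shows "(\<Sum>i\<in>J. a i * (e m \<bullet> e i)\<^sup>2) = a m"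
proof -
  have "(\<Sum>i\<in>J. a i * (e m \<bullet> e i)\<^sup>2) = (\<Sum>i\<in>J. if m = i then a i else 0)"
    using assms by (intro sum.cong refl) (auto simp: frame_inner subset_iff)
  then show ?thesis
    using assms finite_subset[of J] by simp
qed

text \<open>\<open>S\<close> is itself the quadric and its inside is the component; for
  \<open>k = 1\<close> this is a slab between two parallel hyperplanes.\<close>

lemma convex_quadric_ellipsoid:
  fixes S :: "(real^'n) set"
  assumes S: "convex_surface S" and e: "orthonormal_frame e" and k: "1 \<le> k" "k \<le> CARD('n)"
    and a: "\<forall>i\<in>{1..k}. a i > 0"
    and eq: "S = {x. (\<Sum>i=1..k. a i * (cart_coord p e x i)\<^sup>2) = 1}"
  shows "convex_quadric S"
proof (rule convex_quadricI[OF S _ order_refl])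
  have eq': "S = {x. (\<Sum>i\<in>{1..k}. a i * ((x - p) \<bullet> e i)\<^sup>2) = 1}"
    using eq by (simp add: cart_coord_def)
  note r = ellipsoid_region[of "{1..k}" a p e]
  show "{x. (\<Sum>i\<in>{1..k}. a i * ((x - p) \<bullet> e i)\<^sup>2) < 1} \<in> components (UNIV - S)"
    "frontier {x. (\<Sum>i\<in>{1..k}. a i * ((x - p) \<bullet> e i)\<^sup>2) < 1} = S"
    "convex {x. (\<Sum>i\<in>{1..k}. a i * ((x - p) \<bullet> e i)\<^sup>2) < 1}"
    unfolding eq' using r a by auto
  have "(\<Sum>i\<in>{1..k}. a i * (e 1 \<bullet> e i)\<^sup>2) = a 1"
    using k by (intro sum_delta_frame[OF e]) auto
  then have "(\<Sum>i\<in>{1..k}. a i * (e 1 \<bullet> e i)\<^sup>2) \<noteq> 0"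
    using a k by force
  from quadric_surface_sum_squares[OF this, of p 0 "-1"] show "quadric_surface S"
    unfolding eq' by simp
qed

lemma convex_quadric_paraboloid:
  fixes S :: "(real^'n) set"
  assumes S: "convex_surface S" and e: "orthonormal_frame e" and k: "2 \<le> k" "k \<le> CARD('n)"
    and a: "\<forall>i\<in>{1..k-1}. a i > 0"
    and eq: "S = {x. (\<Sum>i=1..k-1. a i * (cart_coord p e x i)\<^sup>2) = cart_coord p e x k}"
  shows "convex_quadric S"
proof (rule convex_quadricI[OF S _ order_refl])
  have eq': "S = {x. (\<Sum>i\<in>{1..k-1}. a i * ((x - p) \<bullet> e i)\<^sup>2) = (x - p) \<bullet> e k}"
    using eq by (simp add: cart_coord_def)
  let ?W = "{x. (\<Sum>i\<in>{1..k-1}. a i * ((x - p) \<bullet> e i)\<^sup>2) < (x - p) \<bullet> e k}"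
  have "norm (e k) = 1"
    using frame_inner[OF e, of k k] k by (simp add: norm_eq_1)
  moreover have "e k \<bullet> e i = 0" if "i \<in> {1..k-1}" for i
    using frame_inner[OF e, of k i] k that by auto
  ultimately show "?W \<in> components (UNIV - S)" "frontier ?W = S" "convex ?W"
    unfolding eq' using paraboloid_region[of "{1..k-1}" a "e k" e p] a by auto
  have "(\<Sum>i\<in>{1..k-1}. a i * (e 1 \<bullet> e i)\<^sup>2) = a 1"
    using k by (intro sum_delta_frame[OF e]) auto
  then have "(\<Sum>i\<in>{1..k-1}. a i * (e 1 \<bullet> e i)\<^sup>2) \<noteq> 0"
    using a k by force
  from quadric_surface_sum_squares[OF this, of p "- e k" 0] show "quadric_surface S"
    unfolding eq' by simp
qed

text \<open>The quadric is all of \<open>F x = c\<close>, and \<open>S\<close> is its part with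
  nonnegative first coordinate. Three of the equations are covered at once: \<open>c = 1\<close>,
  \<open>c = 0\<close>, and the hyperplane as \<open>k = 1\<close>, \<open>c = 0\<close>, where the
  sum from 2 is empty.\<close>

lemma convex_quadric_hyperboloid:
  fixes S :: "(real^'n) set"
  assumes S: "convex_surface S" and e: "orthonormal_frame e" and k: "1 \<le> k" "k \<le> CARD('n)"
    and a: "\<forall>i\<in>{1..k}. a i > 0" and c: "c \<ge> 0"
    and eq: "S = {x. a 1 * (cart_coord p e x 1)\<^sup>2 - (\<Sum>i=2..k. a i * (cart_coord p e x i)\<^sup>2) = c
                  \<and> cart_coord p e x 1 \<ge> 0}"
  shows "convex_quadric S"
proof -
  define F where "F x = a 1 * ((x - p) \<bullet> e 1)\<^sup>2 - (\<Sum>i\<in>{2..k}. a i * ((x - p) \<bullet> e i)\<^sup>2)" for x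
  have eq': "S = {x. F x = c \<and> (x - p) \<bullet> e 1 \<ge> 0}"
    using eq by (simp add: cart_coord_def F_def)
  let ?W = "{x. F x > c \<and> (x - p) \<bullet> e 1 > 0}"
  show ?thesis
  proof (rule convex_quadricI[OF S, of "{x. F x = c}" ?W])
    show "S \<subseteq> {x. F x = c}"
      unfolding eq' by blast
    have "norm (e 1) = 1"
      using frame_inner[OF e, of 1 1] k by (simp add: norm_eq_1)
    moreover have "e 1 \<bullet> e i = 0" if "i \<in> {2..k}" for i
      using frame_inner[OF e, of 1 i] k that by auto
    ultimately show "?W \<in> components (UNIV - {x. F x = c})" "frontier ?W = S" "convex ?W"
      unfolding eq' F_def using hyperboloid_region[of "{2..k}" a "a 1" c "e 1" e p] a c k by auto
    \<comment> \<open>Signed coefficients merge the difference into a single sum, the shape that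
      \<open>quadric_surface_sum_squares\<close> expects.\<close>
    define b where "b i = (if i = 1 then a 1 else - a i)" for i
    have split: "(\<Sum>i\<in>{1..k}. b i * (w \<bullet> e i)\<^sup>2) = a 1 * (w \<bullet> e 1)\<^sup>2 - (\<Sum>i\<in>{2..k}. a i * (w \<bullet> e i)\<^sup>2)" for w
    proof -
      have "{1..k} = insert 1 {2..k}" using k by auto
      moreover have "(\<Sum>i\<in>{2..k}. b i * (w \<bullet> e i)\<^sup>2) = - (\<Sum>i\<in>{2..k}. a i * (w \<bullet> e i)\<^sup>2)"
        unfolding sum_negf[symmetric] by (intro sum.cong refl) (auto simp: b_def)
      ultimately show ?thesis by (simp add: b_def)
    qed
    have "(\<Sum>i\<in>{1..k}. b i * (e 1 \<bullet> e i)\<^sup>2) = b 1"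
      using k by (intro sum_delta_frame[OF e]) auto
    moreover have "b 1 > 0"
      using a k by (auto simp: b_def)
    ultimately have "(\<Sum>i\<in>{1..k}. b i * (e 1 \<bullet> e i)\<^sup>2) \<noteq> 0"
      by simp
    from quadric_surface_sum_squares[OF this, of p 0 "- c"] show "quadric_surface {x. F x = c}"
      unfolding split F_def by simp
  qed
qed

section \<open>Adapted frames and the equivalence\<close>

lemma orthonormal_frame_starting:
  fixes u :: "real^'n"
  assumes "orthonormal (insert u B)" "u \<notin> B"
  obtains e where "orthonormal_frame e" "e 1 = u" "bij_betw e {2..card B + 1} B" "card B + 1 \<le> CARD('n)"
proof -
  obtain e where "orthonormal_frame e" "bij_betw e {1..card {u}} {u}"
    "bij_betw e {card {u} + 1..card {u} + card B} B" "card {u} + card B \<le> CARD('n)"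
    using orthonormal_frame_extending[of "{u}" B] assms by auto
  then show ?thesis
    using that[of e] by (simp add: bij_betw_def numeral_2_eq_2)
qed

text \<open>Moving the base point by \<open>r\<close> along \<open>d\<close> makes the hyperplane
  the zero set of the first coordinate, as in the equation with one vanishing square.\<close>

lemma hyperplane_equation:
  fixes d :: "real^'n"
  assumes d: "norm d = 1"
  obtains e p' where "orthonormal_frame e" "{x. (x - p) \<bullet> d = r} = {x. 1 * (cart_coord p' e x 1)\<^sup>2 = 0}"
proof -
  have "orthonormal (insert d {})"
    using d by (simp add: orthonormal_def norm_eq_1)
  then obtain e where e: "orthonormal_frame e" "e 1 = d"
    using orthonormal_frame_starting[of d "{}"] by auto
  have "{x. (x - p) \<bullet> d = r} = {x. 1 * (cart_coord (p + r *\<^sub>R d) e x 1)\<^sup>2 = 0}"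
    using d e(2) by (auto simp: cart_coord_def inner_diff_left inner_add_left norm_eq_1)
  with e(1) show ?thesis
    using that by blast
qed

theorem corollary1:
  fixes S :: "(real^'n) set"
  assumes "CARD('n) \<ge> 2" and "convex_surface S"
  shows "convex_quadric S \<longleftrightarrow>
    (\<exists>(p :: real^'n) (e :: nat \<Rightarrow> real^'n). orthonormal_frame e \<and>
      ((\<exists>(a :: nat \<Rightarrow> real) k. 1 \<le> k \<and> k \<le> CARD('n) \<and> (\<forall>i\<in>{1..k}. a i > 0) \<and>
          S = {x. (\<Sum>i=1..k. a i * (cart_coord p e x i)\<^sup>2) = 1}) \<or>
       (\<exists>(a :: nat \<Rightarrow> real) k. 2 \<le> k \<and> k \<le> CARD('n) \<and> (\<forall>i\<in>{1..k}. a i > 0) \<and>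
          S = {x. a 1 * (cart_coord p e x 1)\<^sup>2 - (\<Sum>i=2..k. a i * (cart_coord p e x i)\<^sup>2) = 1
                  \<and> cart_coord p e x 1 \<ge> 0}) \<or>
       (\<exists>(a :: nat \<Rightarrow> real). a 1 > 0 \<and>
          S = {x. a 1 * (cart_coord p e x 1)\<^sup>2 = 0}) \<or>
       (\<exists>(a :: nat \<Rightarrow> real) k. 2 \<le> k \<and> k \<le> CARD('n) \<and> (\<forall>i\<in>{1..k}. a i > 0) \<and>
          S = {x. a 1 * (cart_coord p e x 1)\<^sup>2 - (\<Sum>i=2..k. a i * (cart_coord p e x i)\<^sup>2) = 0
                  \<and> cart_coord p e x 1 \<ge> 0}) \<or>
       (\<exists>(a :: nat \<Rightarrow> real) k. 2 \<le> k \<and> k \<le> CARD('n) \<and> (\<forall>i\<in>{1..k-1}. a i > 0) \<and>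
          S = {x. (\<Sum>i=1..k-1. a i * (cart_coord p e x i)\<^sup>2) = cart_coord p e x k})))"
    (is "_ \<longleftrightarrow> (\<exists>p e. orthonormal_frame e \<and> (?E p e \<or> ?H p e \<or> ?P p e \<or> ?C p e \<or> ?B p e))")
proof
  assume "\<exists>p e. orthonormal_frame e \<and> (?E p e \<or> ?H p e \<or> ?P p e \<or> ?C p e \<or> ?B p e)"
  then obtain p e where e: "orthonormal_frame e" and "?E p e \<or> ?H p e \<or> ?P p e \<or> ?C p e \<or> ?B p e"
    by blast
  then consider "?E p e" | "?H p e" | "?P p e" | "?C p e" | "?B p e"
    by blast
  then show "convex_quadric S"
  proof cases
    case 1
    then show ?thesis
      using convex_quadric_ellipsoid[OF assms(2) e] by blast
  next
    case 2
    then obtain a k where "2 \<le> k" "k \<le> CARD('n)" "\<forall>i\<in>{1..k}. a i > 0"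
      "S = {x. a 1 * (cart_coord p e x 1)\<^sup>2 - (\<Sum>i=2..k. a i * (cart_coord p e x i)\<^sup>2) = 1
        \<and> cart_coord p e x 1 \<ge> 0}"
      by blast
    then show ?thesis
      by (intro convex_quadric_hyperboloid[OF assms(2) e, of k a 1 p]) auto
  next
    case 3
    then obtain a :: "nat \<Rightarrow> real" where a: "a 1 > 0" "S = {x. a 1 * (cart_coord p e x 1)\<^sup>2 = 0}"
      by blast
    then show ?thesis
      by (intro convex_quadric_hyperboloid[OF assms(2) e, of 1 a 0 p]) auto
  next
    case 4
    then obtain a k where "2 \<le> k" "k \<le> CARD('n)" "\<forall>i\<in>{1..k}. a i > 0"
      "S = {x. a 1 * (cart_coord p e x 1)\<^sup>2 - (\<Sum>i=2..k. a i * (cart_coord p e x i)\<^sup>2) = 0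
        \<and> cart_coord p e x 1 \<ge> 0}"
      by blast
    then show ?thesis
      by (intro convex_quadric_hyperboloid[OF assms(2) e, of k a 0 p]) auto
  next
    case 5
    then show ?thesis
      using convex_quadric_paraboloid[OF assms(2) e] by blast
  qed
next
  have wrap: "\<exists>p e. orthonormal_frame e \<and> (?E p e \<or> ?H p e \<or> ?P p e \<or> ?C p e \<or> ?B p e)"
    if "orthonormal_frame e" "?E p e \<or> ?H p e \<or> ?P p e \<or> ?C p e \<or> ?B p e" for p e
    by (rule exI[of _ p], rule exI[of _ e], rule conjI) (fact that)+
  assume "convex_quadric S"
  then show "\<exists>p e. orthonormal_frame e \<and> (?E p e \<or> ?H p e \<or> ?P p e \<or> ?C p e \<or> ?B p e)"
  \<comment> \<open>An empty \<open>J\<close> in the second or third case leaves a hyperplane, which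
    falls under the equation with one vanishing square.\<close>
  proof (cases rule: convex_quadric_cases)
    case (ellipsoid J a p)
    obtain e where e: "orthonormal_frame e" "bij_betw e {1..card J} J" "card J \<le> CARD('n)"
      using orthonormal_frame_extending[of J "{}"] ellipsoid(1) by auto
    have "(\<Sum>i=1..card J. (a \<circ> e) i * (cart_coord p e x i)\<^sup>2) = (\<Sum>v\<in>J. a v * ((x - p) \<bullet> v)\<^sup>2)" for x
      using sum.reindex_bij_betw[OF e(2), of "\<lambda>v. a v * ((x - p) \<bullet> v)\<^sup>2"] by (simp add: cart_coord_def)
    then have S: "S = {x. (\<Sum>i=1..card J. (a \<circ> e) i * (cart_coord p e x i)\<^sup>2) = 1}"
      using ellipsoid(4) by simp
    have pos: "\<forall>i\<in>{1..card J}. (a \<circ> e) i > 0"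
      using e(2) ellipsoid(3) bij_betwE by fastforce
    have k: "1 \<le> card J"
      using ellipsoid(1,2) orthonormal_finite by (simp add: Suc_le_eq card_gt_0_iff)
    have "?E p e"
      by (rule exI[of _ "a \<circ> e"], rule exI[of _ "card J"], intro conjI) (fact k e(3) pos S)+
    then show ?thesis
      by (rule wrap[OF e(1), OF disjI1])
  next
    case (hyperboloid J u a c p)
    show ?thesis
    proof (cases "J = {}")
      case True
      have "a u > 0" "norm u = 1"
        using hyperboloid(1,3) by (auto simp: orthonormal_def norm_eq_1)
      \<comment> \<open>The condition of nonnegative height singles out one of the two roots, so a
        single hyperplane remains.\<close>
      have "t\<^sup>2 = c / a u \<and> t \<ge> 0 \<longleftrightarrow> t = sqrt (c / a u)" for t
        using \<open>a u > 0\<close> hyperboloid(4) by (auto simp: real_sqrt_unique)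
      moreover have "a u * t = c \<longleftrightarrow> t = c / a u" for t
        using \<open>a u > 0\<close> by (simp add: field_simps)
      ultimately have S: "S = {x. (x - p) \<bullet> u = sqrt (c / a u)}"
        using hyperboloid(5) True by simp
      obtain e p' where e: "orthonormal_frame e"
        "{x. (x - p) \<bullet> u = sqrt (c / a u)} = {x. 1 * (cart_coord p' e x 1)\<^sup>2 = 0}"
        using hyperplane_equation[OF \<open>norm u = 1\<close>] .
      have "?P p' e"
        unfolding S e(2) by (rule exI[of _ "\<lambda>_. 1"]) simp
      then show ?thesis
        by (rule wrap[OF e(1), OF disjI2, OF disjI2, OF disjI1])
    next
      case False
      obtain e where e: "orthonormal_frame e" "e 1 = u" "bij_betw e {2..card J + 1} J"
        "card J + 1 \<le> CARD('n)"
        using orthonormal_frame_starting[OF hyperboloid(1,2)] .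
      let ?k = "card J + 1"
      have "(\<Sum>i=2..?k. (a \<circ> e) i * (cart_coord p e x i)\<^sup>2) = (\<Sum>v\<in>J. a v * ((x - p) \<bullet> v)\<^sup>2)" for x
        using sum.reindex_bij_betw[OF e(3), of "\<lambda>v. a v * ((x - p) \<bullet> v)\<^sup>2"] by (simp add: cart_coord_def)
      moreover have "(a \<circ> e) 1 = a u" and "cart_coord p e x 1 = (x - p) \<bullet> u" for x
        using e(2) by (simp_all add: cart_coord_def)
      ultimately have S: "S = {x. (a \<circ> e) 1 * (cart_coord p e x 1)\<^sup>2
          - (\<Sum>i=2..?k. (a \<circ> e) i * (cart_coord p e x i)\<^sup>2) = c \<and> cart_coord p e x 1 \<ge> 0}"
        using hyperboloid(5) by (simp only:)
      have pos: "\<forall>i\<in>{1..?k}. (a \<circ> e) i > 0"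
      proof
        fix i assume "i \<in> {1..?k}"
        then have "i = 1 \<or> i \<in> {2..?k}"
          by auto
        then have "e i \<in> insert u J"
          using e(2) bij_betwE[OF e(3)] by blast
        then show "(a \<circ> e) i > 0"
          using hyperboloid(3) by simp
      qed
      have "finite J"
        using orthonormal_finite[OF hyperboloid(1)] by simp
      then have k: "2 \<le> ?k"
        using False by (simp add: Suc_le_eq card_gt_0_iff)
      from hyperboloid(4) show ?thesis
      proof
        assume c: "c = 0"
        have "?C p e"
          by (rule exI[of _ "a \<circ> e"], rule exI[of _ ?k], intro conjI) (fact k e(4) pos S[unfolded c])+
        then show ?thesis
          by (rule wrap[OF e(1), OF disjI2, OF disjI2, OF disjI2, OF disjI1])
      next
        assume c: "c = 1"
        have "?H p e"
          by (rule exI[of _ "a \<circ> e"], rule exI[of _ ?k], intro conjI) (fact k e(4) pos S[unfolded c])+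
        then show ?thesis
          by (rule wrap[OF e(1), OF disjI2, OF disjI1])
      qed
    qed
  next
    case (paraboloid J d a p)
    show ?thesis
    proof (cases "J = {}")
      case True
      have "norm d = 1"
        using paraboloid(1) by (simp add: orthonormal_def norm_eq_1)
      obtain e p' where e: "orthonormal_frame e"
        "{x. (x - p) \<bullet> d = 0} = {x. 1 * (cart_coord p' e x 1)\<^sup>2 = 0}"
        using hyperplane_equation[OF \<open>norm d = 1\<close>] .
      have S: "S = {x. (x - p) \<bullet> d = 0}"
        unfolding paraboloid(4) True by auto
      have "?P p' e"
        unfolding S e(2) by (rule exI[of _ "\<lambda>_. 1"]) simp
      then show ?thesis
        by (rule wrap[OF e(1), OF disjI2, OF disjI2, OF disjI1])
    next
      case False
      have "orthonormal (J \<union> {d})" "J \<inter> {d} = {}"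
        using paraboloid(1,2) by simp_all
      then obtain e where e: "orthonormal_frame e" "bij_betw e {1..card J} J"
        "bij_betw e {card J + 1..card J + card {d}} {d}" "card J + card {d} \<le> CARD('n)"
        by (rule orthonormal_frame_extending)
      \<comment> \<open>The axis \<open>d\<close> comes directly after the vectors of
        \<open>J\<close>, so the squares run up to \<open>?k - 1\<close>, which is
        \<open>card J\<close>.\<close>
      let ?k = "card J + 1"
      have "e ?k = d"
        using e(3) by (simp add: bij_betw_def)
      have "(\<Sum>i=1..?k - 1. (a \<circ> e) i * (cart_coord p e x i)\<^sup>2) = (\<Sum>v\<in>J. a v * ((x - p) \<bullet> v)\<^sup>2)" for x
        using sum.reindex_bij_betw[OF e(2), of "\<lambda>v. a v * ((x - p) \<bullet> v)\<^sup>2"] by (simp add: cart_coord_def)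
      moreover have "cart_coord p e x ?k = (x - p) \<bullet> d" for x
        using \<open>e ?k = d\<close> by (simp add: cart_coord_def)
      ultimately have S: "S = {x. (\<Sum>i=1..?k - 1. (a \<circ> e) i * (cart_coord p e x i)\<^sup>2) = cart_coord p e x ?k}"
        using paraboloid(4) by simp
      have pos: "\<forall>i\<in>{1..?k - 1}. (a \<circ> e) i > 0"
        using e(2) paraboloid(3) bij_betwE by fastforce
      have "finite J"
        using orthonormal_finite[OF paraboloid(1)] by simp
      then have k: "2 \<le> ?k"
        using False by (simp add: Suc_le_eq card_gt_0_iff)
      have kn: "?k \<le> CARD('n)"
        using e(4) by simp
      have "?B p e"
        by (rule exI[of _ "a \<circ> e"], rule exI[of _ ?k], intro conjI) (fact k kn pos S)+
      then show ?thesis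
        by (rule wrap[OF e(1), OF disjI2, OF disjI2, OF disjI2, OF disjI2])
    qed
  qed
qed

end
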